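(* Consider the noisy search problem with $1/\delta=2^L$ and the dyadic Posterior Matching strategy ($dyaPM$) described in the context, run with the variable-length stopping rule. For reliability $0<\epsilon<1$, the expected search time satisfies $$\mathbb{E}[\tau_{\epsilon,\delta}] \le \frac{\log(1/\delta)}{I(1/2,\,p[2^{-l}])} + \frac{\log(1/\epsilon)}{C_1(p[\delta])} + o\Big(\log\frac{1}{\delta\epsilon}\Big),$$ for any fixed $l>0$ such that $2^{-l} > \big(e\log\frac{1}{\delta\epsilon}\big)^{-K_d}$, where $$K_d := \min\Big\{ \min_{\rho\in[0,1/4]}\max\{f(\rho),g(\rho)\},\ \min_{\rho\in[1/4,1/2]} f(\rho),\ \tfrac14 D\big(\tfrac14 B_1+\tfrac34 B_0\,\big\|\,B_0\big)\Big\}>0,$$ with $B_1=\mathrm{Bern}(1-p[1/2])$, $B_0=\mathrm{Bern}(p[1/2])$, $f(\rho):=\rho\, D\big(B_1\,\|\,\tfrac34 B_1+\tfrac14 B_0\big)$ and $g(\rho):=(\tfrac12-\rho)\,D\big((1-4\rho)B_1+4\rho B_0\,\|\,(\tfrac12+\rho)B_1+(\tfrac12-\rho)B_0\big)$.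
   Context: Search problem: fix $\delta\in(0,1)$ with $N=1/\delta=2^L$ for an integer $L$. A target index $\theta$ is uniformly distributed on $\{1,\dots,N\}$. A noise profile $p:(0,1)\to(0,1/2)$ is continuous and non-decreasing; write $p[x]:=p(x)$. At each time $t=1,2,\dots$ an agent chooses a query set $S_t\subseteq\{1,\dots,N\}$ as a function of past queries and observations, and observes $Y_t=\mathbb{1}(\theta\in S_t)\oplus Z_t$ ($\oplus$ = XOR), where conditionally on $S_t$, $Z_t\sim\mathrm{Bern}(p[\delta|S_t|])$, conditionally i.i.d. across time. The posterior is $\pi_i(t)=\mathbb{P}(\theta=i\mid S_1,\dots,S_t,Y_1,\dots,Y_t)$ with $\pi_i(0)=\delta$; write $\pi_S=\sum_{i\in S}\pi_i$ and $\pi_{[a,b]}=\sum_{i=a}^b\pi_i$. Variable-length stopping rule: $\tau_{\epsilon,\delta}$ is the first $t$ with $\max_i\pi_i(t)>1-\epsilon$, estimate $\hat\theta=\arg\max_i\pi_i(\tau)$. $dyaPM$: let $H_l^m=\{m2^{L-l}+1,\dots,(m+1)2^{L-l}\}$ for $l=0,\dots,L$, $m=0,\dots,2^l-1$. At time $t$, let $l^*_t$ be the largest $l$ with $\max_m\pi_{H_l^m}(t)\ge\tfrac12$, $m^*_t=\arg\max_m\pi_{H^m_{l^*_t}}(t)$, $d=m^*_t2^{L-l^*_t}+1$, $k^*=\arg\min_k|\pi_{[d,k]}(t)-\tfrac12|$, and query $S_{t+1}=\{d,d+1,\dots,k^*\}$. Notation: $D(\cdot\|\cdot)$ is KL divergence;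 a convex combination of Bernoulli distributions denotes their mixture. $I(q,p)$ is the mutual information between input $X\sim\mathrm{Bern}(q)$ and the output of a binary symmetric channel with crossover probability $p$. $C_1(p):=D(\mathrm{Bern}(p)\|\mathrm{Bern}(1-p))$. The $o(\cdot)$ term is as $\delta\to0$ or $\epsilon\to0$. *)

theory Defs
  imports Complex_Main "HOL-Library.Extended_Nonnegative_Real"
begin

text \<open>A Bernoulli distribution is represented by its success probability;
  a convex combination of Bernoulli distributions is the Bernoulli distribution
  with the convex combination of the parameters.\<close>

definition kl_bern :: "real \<Rightarrow> real \<Rightarrow> real" where
  "kl_bern a b = a * ln (a / b) + (1 - a) * ln ((1 - a) / (1 - b))"

definition mutual_info_bsc :: "real \<Rightarrow> real \<Rightarrow> real" where
  "mutual_info_bsc q p =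
     (let px = (\<lambda>x::bool. if x then q else 1 - q);
          pxy = (\<lambda>x y::bool. px x * (if y = x then 1 - p else p));
          py = (\<lambda>y. \<Sum>x\<in>UNIV. pxy x y)
      in \<Sum>x\<in>UNIV. \<Sum>y\<in>UNIV. pxy x y * ln (pxy x y / (px x * py y)))"

definition C1 :: "real \<Rightarrow> real" where
  "C1 p = kl_bern p (1 - p)"

definition K_d :: "(real \<Rightarrow> real) \<Rightarrow> real" where
  "K_d p =
     (let b1 = 1 - p (1/2); b0 = p (1/2);
          f = (\<lambda>\<rho>. \<rho> * kl_bern b1 (3/4 * b1 + 1/4 * b0));
          g = (\<lambda>\<rho>. (1/2 - \<rho>) * kl_bern ((1 - 4*\<rho>) * b1 + 4*\<rho> * b0)
                                        ((1/2 + \<rho>) * b1 + (1/2 - \<rho>) * b0))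
      in min (INF \<rho>\<in>{0..1/4}. max (f \<rho>) (g \<rho>))
             (min (INF \<rho>\<in>{1/4..1/2}. f \<rho>)
                  (1/4 * kl_bern (1/4 * b1 + 3/4 * b0) b0)))"

text \<open>N = 2^L items, indexed 1..N; delta = 1/N. Posteriors are functions nat => real.\<close>

definition mass :: "(nat \<Rightarrow> real) \<Rightarrow> nat set \<Rightarrow> real" where
  "mass \<pi> S = (\<Sum>i\<in>S. \<pi> i)"

definition dyblock :: "nat \<Rightarrow> nat \<Rightarrow> nat \<Rightarrow> nat set" where
  "dyblock L l m = {m * 2^(L - l) + 1 .. (m + 1) * 2^(L - l)}"

definition blockmax :: "nat \<Rightarrow> (nat \<Rightarrow> real) \<Rightarrow> nat \<Rightarrow> real" where
  "blockmax L \<pi> l = Max ((\<lambda>m. mass \<pi> (dyblock L l m)) ` {..<2^l})"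

definition dyaPM_query :: "nat \<Rightarrow> (nat \<Rightarrow> real) \<Rightarrow> nat set" where
  "dyaPM_query L \<pi> =
     (let N = 2^L;
          ls = (GREATEST l. l \<le> L \<and> blockmax L \<pi> l \<ge> 1/2);
          ms = (LEAST m. m < 2^ls \<and> mass \<pi> (dyblock L ls m) = blockmax L \<pi> ls);
          d = ms * 2^(L - ls) + 1;
          dev = (\<lambda>k. \<bar>mass \<pi> {d..k} - 1/2\<bar>);
          ks = (LEAST k. k \<in> {d..N} \<and> dev k = Min (dev ` {d..N}))
      in {d..ks})"

text \<open>Likelihood P(Y = y | theta = i, S): Y = [i in S] XOR Z, Z ~ Bern(p(delta |S|)).\<close>
definition lik :: "(real \<Rightarrow> real) \<Rightarrow> nat \<Rightarrow> nat set \<Rightarrow> nat \<Rightarrow> bool \<Rightarrow> real" where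
  "lik p L S i y = (let q = p (card S / 2^L) in if y = (i \<in> S) then 1 - q else q)"

definition normalize_post :: "nat \<Rightarrow> (nat \<Rightarrow> real) \<Rightarrow> nat \<Rightarrow> real" where
  "normalize_post L v = (\<lambda>i. v i / (\<Sum>j\<in>{1..2^L}. v j))"

text \<open>joint p L h i = P(theta = i, Y_1..Y_t = h) under dyaPM, where the
  observation history h is stored most-recent-first (h = [Y_t, ..., Y_1]).\<close>
fun joint :: "(real \<Rightarrow> real) \<Rightarrow> nat \<Rightarrow> bool list \<Rightarrow> nat \<Rightarrow> real" where
  "joint p L [] i = (if i \<in> {1..2^L} then 1 / 2^L else 0)"
| "joint p L (y # h) i =
     joint p L h i * lik p L (dyaPM_query L (normalize_post L (joint p L h))) i y"

definition posterior :: "(real \<Rightarrow> real) \<Rightarrow> nat \<Rightarrow> bool list \<Rightarrow> nat \<Rightarrow> real" where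
  "posterior p L h = normalize_post L (joint p L h)"

definition hist_prob :: "(real \<Rightarrow> real) \<Rightarrow> nat \<Rightarrow> bool list \<Rightarrow> real" where
  "hist_prob p L h = (\<Sum>i\<in>{1..2^L}. joint p L h i)"

definition stopped :: "(real \<Rightarrow> real) \<Rightarrow> nat \<Rightarrow> real \<Rightarrow> bool list \<Rightarrow> bool" where
  "stopped p L \<epsilon> h \<longleftrightarrow> (\<exists>i\<in>{1..2^L}. posterior p L h i > 1 - \<epsilon>)"

definition prob_tau_eq :: "(real \<Rightarrow> real) \<Rightarrow> nat \<Rightarrow> real \<Rightarrow> nat \<Rightarrow> real" where
  "prob_tau_eq p L \<epsilon> t =
     (\<Sum>h\<in>{h::bool list. length h = t \<and> stopped p L \<epsilon> h \<and>
                            (\<forall>k\<in>{1..t}. \<not> stopped p L \<epsilon> (drop k h))}.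
        hist_prob p L h)"

text \<open>E[tau] for the [0,infinity]-valued stopping time tau (value infinity if tau = infinity
  with positive probability).\<close>
definition expected_tau :: "(real \<Rightarrow> real) \<Rightarrow> nat \<Rightarrow> real \<Rightarrow> ennreal" where
  "expected_tau p L \<epsilon> =
     (\<Sum>t. of_nat t * ennreal (prob_tau_eq p L \<epsilon> t)) +
     (if (\<Sum>t. ennreal (prob_tau_eq p L \<epsilon> t)) < 1 then \<infinity> else 0)"

end

theory Submission
  imports Defs
begin

text \<open>A potential function argument. Call a state far if all posterior masses are below a small
  \<open>\<kappa>\<close>, near if some mass exceeds \<open>1 - \<kappa>\<close>, and intermediate otherwise, and call it coarse
  if the query has more than a fraction \<open>2^(-r)\<close> of the items, where \<open>r \<ge> l\<close>.
  In a far state that is not coarse the query has mass within \<open>\<kappa>/2\<close> of 1/2, so the entropy of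
  the posterior, initially \<open>L ln 2\<close>, decreases by at least \<open>(1 - \<kappa>) I(1/2, p[2^(-r)])\<close> on average.
  In a near state the query is a single item, and the largest log-odds, truncated below at the
  level that corresponds to \<open>1 - \<kappa>\<close>, increases by at least \<open>(1 - 2\<kappa>) C1(p[\<delta>])\<close> on average and
  by at most \<open>C1(p[\<delta>]) / (1 - 2p[\<delta>])\<close>, so the overshoot at the stopping time costs a bounded
  number of steps.
  The sum of the squared masses of the blocks at a fixed level is a bounded submartingale; in an
  intermediate state that of the single items, and in a coarse state that of the blocks at level
  \<open>r\<close>, increases by a constant. Hence the expected number of intermediate and of coarse steps is
  bounded independently of \<open>L\<close> and \<open>\<epsilon>\<close>. As \<open>l\<close> is fixed, the condition on \<open>2^(-l)\<close> only
  excludes small values of \<open>ln (1/(\<delta>\<epsilon>))\<close>, so of \<open>K_d\<close> only the positivity matters.\<close>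

subsection \<open>Binary entropy and divergence\<close>

definition binent :: "real \<Rightarrow> real" where
  "binent a = - a * ln a - (1 - a) * ln (1 - a)"

text \<open>The tangent of \<open>ln\<close> gives \<open>w * (ln m - ln w) \<le> m - w\<close> at
  each \<open>w\<close>; averaged over \<open>u\<close> and \<open>v\<close>, the right-hand sides
  cancel because \<open>m\<close> is the mean.\<close>

lemma xlnx_convex:
  fixes u v s :: real
  assumes "0 < u" "0 < v" "0 \<le> s" "s \<le> 1"
  defines "m \<equiv> (1 - s) * u + s * v"
  shows "m * ln m \<le> (1 - s) * (u * ln u) + s * (v * ln v)"
proof -
  have m: "0 < m"
  proof (cases "s = 0")
    case False
    then show ?thesis using assms unfolding m_def
      by (intro add_nonneg_pos mult_nonneg_nonneg mult_pos_pos) auto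
  qed (use assms in auto)
  have tangent: "w * (ln m - ln w) \<le> m - w" if "0 < w" for w
  proof -
    have "w * (ln m - ln w) = w * ln (m / w)" using m that by (simp add: ln_div)
    also have "\<dots> \<le> w * (m / w - 1)"
      using m that by (intro mult_left_mono ln_le_minus_one) auto
    also have "\<dots> = m - w" using that by (simp add: field_simps)
    finally show ?thesis .
  qed
  have "(1 - s) * (u * (ln m - ln u)) + s * (v * (ln m - ln v)) \<le> (1 - s) * (m - u) + s * (m - v)"
    using assms by (intro add_mono mult_left_mono tangent) auto
  also have "\<dots> = 0" unfolding m_def by (simp add: algebra_simps)
  finally have "((1 - s) * u + s * v) * ln m \<le> (1 - s) * (u * ln u) + s * (v * ln v)"
    by (simp add: algebra_simps)
  then show ?thesis by (simp add: m_def)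
qed

lemma binent_concave:
  fixes u v s :: real
  assumes "0 < u" "u < 1" "0 < v" "v < 1" "0 \<le> s" "s \<le> 1"
  shows "(1 - s) * binent u + s * binent v \<le> binent ((1 - s) * u + s * v)"
proof -
  have eq: "1 - ((1 - s) * u + s * v) = (1 - s) * (1 - u) + s * (1 - v)"
    by (simp add: algebra_simps)
  show ?thesis
    using xlnx_convex[of u v s] xlnx_convex[of "1 - u" "1 - v" s] assms
    unfolding binent_def eq by (simp add: algebra_simps)
qed

lemma binent_half: "binent (1/2) = ln 2"
  by (simp add: binent_def ln_div)

lemma binent_commute: "binent (1 - a) = binent a"
  by (simp add: binent_def algebra_simps)

lemma binent_le_ln2:
  assumes "0 < a" "a < 1"
  shows "binent a \<le> ln 2"
  using binent_concave[of a "1 - a" "1/2"] assms by (simp add: binent_half binent_commute field_simps)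

text \<open>The point \<open>b\<close> is a convex combination of \<open>a\<close> and the maximiser
  1/2, so concavity keeps \<open>binent b\<close> above the smaller end value.\<close>

lemma binent_mono:
  assumes "0 < a" "a \<le> b" "b \<le> 1/2"
  shows "binent a \<le> binent b"
proof (cases "a = b")
  case False
  define s where "s = (b - a) / (1/2 - a)"
  have s: "0 \<le> s" "s \<le> 1" using assms False by (auto simp: s_def field_simps)
  have "s * (1/2 - a) = b - a" using assms False by (simp add: s_def)
  then have b: "b = (1 - s) * a + s * (1/2)" by (simp add: algebra_simps)
  have "binent a = (1 - s) * binent a + s * binent a" by (simp add: algebra_simps)
  also have "\<dots> \<le> (1 - s) * binent a + s * ln 2"
    using s assms by (intro add_left_mono mult_left_mono binent_le_ln2) auto
  also have "\<dots> \<le> binent b"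
    unfolding b using binent_concave[of a "1/2" s] s assms by (simp add: binent_half)
  finally show ?thesis .
qed simp

text \<open>Termwise \<open>u * ln (u / v) > u - v\<close> for distinct arguments, and the linear
  parts for \<open>a\<close>, \<open>b\<close> and for \<open>1 - a\<close>, \<open>1 - b\<close>
  add up to zero.\<close>

lemma kl_bern_pos:
  assumes "0 < a" "a < 1" "0 < b" "b < 1" "a \<noteq> b"
  shows "kl_bern a b > 0"
proof -
  have strict: "u * ln (u / v) > u - v" if "0 < u" "0 < v" "u \<noteq> v" for u v :: real
  proof -
    have "ln (v / u) < v / u - 1"
      using ln_le_minus_one[of "v / u"] ln_eq_minus_one[of "v / u"] that by fastforce
    then have "u * ln (v / u) < u * (v / u - 1)" using that by (intro mult_strict_left_mono)
    moreover have "u * ln (v / u) = - (u * ln (u / v))" using that by (simp add: ln_div algebra_simps)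
    moreover have "u * (v / u - 1) = v - u" using that by (simp add: field_simps)
    ultimately show ?thesis by linarith
  qed
  show ?thesis
    using strict[of a b] strict[of "1 - a" "1 - b"] assms unfolding kl_bern_def by linarith
qed

lemma mutual_info_bsc_half:
  assumes "0 < q" "q < 1"
  shows "mutual_info_bsc (1/2) q = ln 2 - binent q"
proof -
  have "ln (2 - 2 * q) = ln 2 + ln (1 - q)"
    using assms ln_mult[of 2 "1 - q"] by (simp add: algebra_simps)
  then show ?thesis
    using assms by (simp add: mutual_info_bsc_def Let_def UNIV_bool binent_def ln_mult algebra_simps)
qed

lemma mutual_info_bsc_half_pos:
  assumes "0 < q" "q < 1/2"
  shows "mutual_info_bsc (1/2) q > 0"
proof -
  have "kl_bern q (1/2) > 0" using assms by (intro kl_bern_pos) auto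
  also have "kl_bern q (1/2) = ln 2 - binent q"
    using assms ln_mult[of 2 "1 - q"]
    by (simp add: kl_bern_def binent_def ln_mult algebra_simps)
  finally show ?thesis using assms by (simp add: mutual_info_bsc_half)
qed

lemma mutual_info_bsc_half_antimono:
  assumes "0 < q" "q \<le> q'" "q' < 1/2"
  shows "mutual_info_bsc (1/2) q' \<le> mutual_info_bsc (1/2) q"
  using binent_mono[of q q'] assms by (simp add: mutual_info_bsc_half)

lemma C1_eq:
  assumes "0 < q" "q < 1"
  shows "C1 q = (1 - 2 * q) * ln ((1 - q) / q)"
  using assms by (simp add: C1_def kl_bern_def ln_div algebra_simps)

lemma log_ratio_antimono:
  assumes "0 < (q::real)" "q \<le> q'" "q' < 1"
  shows "ln ((1 - q') / q') \<le> ln ((1 - q) / q)"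
  using assms by (simp add: frac_le)

lemma log_ratio_nonneg:
  assumes "0 < (q::real)" "q \<le> 1/2"
  shows "0 \<le> ln ((1 - q) / q)"
  using assms by (intro ln_ge_zero) (simp add: field_simps)

lemma C1_antimono:
  assumes "0 < q" "q \<le> q'" "q' < 1/2"
  shows "C1 q' \<le> C1 q"
  using assms log_ratio_antimono[of q q'] log_ratio_nonneg[of q'] 
  by (simp add: C1_eq) (intro mult_mono, auto)

lemma C1_pos:
  assumes "0 < q" "q < 1/2"
  shows "C1 q > 0"
  using assms unfolding C1_def by (intro kl_bern_pos) auto

text \<open>By compactness the first infimum is attained; at the minimiser either
  \<open>\<rho> > 0\<close> makes \<open>f\<close> positive, or \<open>g 0 > 0\<close>
  applies.\<close>

lemma K_d_pos:
  assumes "0 < p (1/2)" "p (1/2) < 1/2"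
  shows "K_d p > 0"
proof -
  define b0 b1 where "b0 = p (1/2)" and "b1 = 1 - p (1/2)"
  define K where "K = kl_bern b1 (3/4 * b1 + 1/4 * b0)"
  define g where "g = (\<lambda>\<rho>. (1/2 - \<rho>) * kl_bern ((1 - 4*\<rho>) * b1 + 4*\<rho> * b0)
                                        ((1/2 + \<rho>) * b1 + (1/2 - \<rho>) * b0))"
  have b: "0 < b0" "b0 < b1" "b1 < 1" using assms by (auto simp: b0_def b1_def)
  have K: "K > 0" unfolding K_def using b by (intro kl_bern_pos) auto
  \<comment> \<open>Mixtures of \<open>b1\<close> and \<open>b0\<close> stay inside (0, 1), so no
    logarithm in \<open>g\<close> is singular.\<close>
  have mix: "0 < s * b1 + t * b0" "s * b1 + t * b0 < 1"
    if "0 \<le> s" "0 \<le> t" "s + t = 1" for s t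
  proof -
    have t: "s * b0 + t * b0 = b0" "s * b1 + t * b1 = b1"
      using that by (metis distrib_right mult_1)+
    have "s * b0 \<le> s * b1" "t * b0 \<le> t * b1" using that b by (auto intro!: mult_left_mono)
    with t b show "0 < s * b1 + t * b0" "s * b1 + t * b0 < 1" by linarith+
  qed
  have "continuous_on {0..1/4} g"
  proof -
    have 1: "0 < (1 - 4*\<rho>) * b1 + 4*\<rho> * b0" "(1 - 4*\<rho>) * b1 + 4*\<rho> * b0 < 1"
      "0 < (1/2 + \<rho>) * b1 + (1/2 - \<rho>) * b0" "(1/2 + \<rho>) * b1 + (1/2 - \<rho>) * b0 < 1"
      if "\<rho> \<in> {0..1/4}" for \<rho> using mix[of "1 - 4*\<rho>" "4*\<rho>"] mix[of "1/2+\<rho>" "1/2-\<rho>"] that by auto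
    show ?thesis unfolding g_def kl_bern_def
      by (intro continuous_intros ballI) (use 1 in \<open>fastforce\<close>)+
  qed
  then have "continuous_on {0..1/4} (\<lambda>\<rho>. max (\<rho> * K) (g \<rho>))"
    by (intro continuous_intros)
  then obtain \<rho>0 where \<rho>0: "\<rho>0 \<in> {0..1/4}"
    "\<And>\<rho>. \<rho> \<in> {0..1/4} \<Longrightarrow> max (\<rho>0 * K) (g \<rho>0) \<le> max (\<rho> * K) (g \<rho>)"
    using continuous_attains_inf[of "{0..1/4::real}" "\<lambda>\<rho>. max (\<rho> * K) (g \<rho>)"] by auto
  have "g 0 > 0"
    unfolding g_def using b by (intro mult_pos_pos kl_bern_pos) auto
  then have "0 < max (\<rho>0 * K) (g \<rho>0)"
    using \<rho>0(1) K by (cases "\<rho>0 = 0") (auto simp: less_max_iff_disj)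
  also have "\<dots> \<le> (INF \<rho>\<in>{0..1/4}. max (\<rho> * K) (g \<rho>))"
    using \<rho>0(2) by (intro cINF_greatest) auto
  finally have 1: "0 < (INF \<rho>\<in>{0..1/4}. max (\<rho> * K) (g \<rho>))" .
  have "0 < 1/4 * K" using K by simp
  also have "\<dots> \<le> (INF \<rho>\<in>{1/4..1/2}. \<rho> * K)"
    using K by (intro cINF_greatest) (auto intro!: mult_right_mono)
  finally have 2: "0 < (INF \<rho>\<in>{1/4..1/2}. \<rho> * K)" .
  have 3: "0 < 1/4 * kl_bern (1/4 * b1 + 3/4 * b0) b0"
    using b by (intro mult_pos_pos kl_bern_pos) auto
  show ?thesis
    using 1 2 3 unfolding K_d_def Let_def K_def g_def b0_def b1_def by simp
qed

subsection \<open>Bayesian updates for a noisy query\<close>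

text \<open>Masses are strictly positive, which updates with noise in (0, 1/2) preserve; logarithms
  are then taken of positive numbers only.\<close>

definition prob_vec :: "nat \<Rightarrow> (nat \<Rightarrow> real) \<Rightarrow> bool" where
  "prob_vec N \<pi> \<longleftrightarrow> (\<forall>i\<in>{1..N}. 0 < \<pi> i) \<and> mass \<pi> {1..N} = 1"

lemma mass_nonneg: "prob_vec N \<pi> \<Longrightarrow> J \<subseteq> {1..N} \<Longrightarrow> 0 \<le> mass \<pi> J"
  unfolding mass_def prob_vec_def by (intro sum_nonneg) (auto intro: less_imp_le)

lemma mass_mono: "prob_vec N \<pi> \<Longrightarrow> J \<subseteq> {1..N} \<Longrightarrow> I \<subseteq> J \<Longrightarrow> mass \<pi> I \<le> mass \<pi> J"
  unfolding mass_def prob_vec_def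
  by (intro sum_mono2) (auto intro: less_imp_le elim: finite_subset[OF _ finite_atLeastAtMost])

lemma mass_le_1: "prob_vec N \<pi> \<Longrightarrow> J \<subseteq> {1..N} \<Longrightarrow> mass \<pi> J \<le> 1"
  using mass_mono[of N \<pi> "{1..N}" J] by (simp add: prob_vec_def)

lemma mass_compl:
  "prob_vec N \<pi> \<Longrightarrow> J \<subseteq> {1..N} \<Longrightarrow> mass \<pi> ({1..N} - J) = 1 - mass \<pi> J"
  unfolding mass_def prob_vec_def by (simp add: sum_diff)

lemma mass_sing [simp]: "mass \<pi> {i} = \<pi> i"
  by (simp add: mass_def)

lemma prob_vec_pos: "prob_vec N \<pi> \<Longrightarrow> i \<in> {1..N} \<Longrightarrow> 0 < \<pi> i"
  by (simp add: prob_vec_def)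

lemma prob_vec_le_1: "prob_vec N \<pi> \<Longrightarrow> i \<in> {1..N} \<Longrightarrow> \<pi> i \<le> 1"
  using mass_le_1[of N \<pi> "{i}"] by simp

lemma prob_vec_less_1:
  assumes "prob_vec N \<pi>" "i \<in> {1..N}" "2 \<le> N"
  shows "\<pi> i < 1"
proof -
  define j :: nat where "j = (if i = 1 then 2 else 1)"
  have j: "j \<in> {1..N}" "j \<noteq> i" using assms by (auto simp: j_def)
  have "\<pi> i + \<pi> j = mass \<pi> {i, j}" using j by (simp add: mass_def)
  also have "\<dots> \<le> 1" using assms j by (intro mass_le_1) auto
  finally show ?thesis using prob_vec_pos[OF assms(1) j(1)] by simp
qed

lemma prob_vec_normalize:
  assumes "1 \<le> N" "\<And>i. i \<in> {1..N} \<Longrightarrow> 0 < v i"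
  shows "0 < (\<Sum>i\<in>{1..N}. v i)" "prob_vec N (\<lambda>i. v i / (\<Sum>j\<in>{1..N}. v j))"
proof -
  show *: "0 < (\<Sum>i\<in>{1..N}. v i)" using assms by (intro sum_pos) auto
  show "prob_vec N (\<lambda>i. v i / (\<Sum>j\<in>{1..N}. v j))"
    unfolding prob_vec_def mass_def using assms * by (simp flip: sum_divide_distrib)
qed

text \<open>The crossover probability is a free parameter here, not a function of the size of
  \<open>S\<close>, so that one update can be studied for a fixed channel.\<close>

definition lkl :: "real \<Rightarrow> nat set \<Rightarrow> nat \<Rightarrow> bool \<Rightarrow> real" where
  "lkl q S i y = (if y = (i \<in> S) then 1 - q else q)"

definition evidence :: "nat \<Rightarrow> real \<Rightarrow> nat set \<Rightarrow> (nat \<Rightarrow> real) \<Rightarrow> bool \<Rightarrow> real" where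
  "evidence N q S \<pi> y = (\<Sum>i\<in>{1..N}. \<pi> i * lkl q S i y)"

definition bayes :: "nat \<Rightarrow> real \<Rightarrow> nat set \<Rightarrow> (nat \<Rightarrow> real) \<Rightarrow> bool \<Rightarrow> nat \<Rightarrow> real" where
  "bayes N q S \<pi> y i = \<pi> i * lkl q S i y / evidence N q S \<pi> y"

text \<open>Conditional expectation of \<open>\<phi>\<close> at the next posterior, given the
  current posterior \<open>\<pi>\<close>.\<close>

definition expected_update ::
    "nat \<Rightarrow> real \<Rightarrow> nat set \<Rightarrow> (nat \<Rightarrow> real) \<Rightarrow> ((nat \<Rightarrow> real) \<Rightarrow> real) \<Rightarrow> real" where
  "expected_update N q S \<pi> \<phi> =
     (\<Sum>y\<in>UNIV. evidence N q S \<pi> y * \<phi> (bayes N q S \<pi> y))"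

locale bsc_query =
  fixes N :: nat and q :: real and S :: "nat set" and \<pi> :: "nat \<Rightarrow> real"
  assumes prob_vec: "prob_vec N \<pi>"
    and S_sub: "S \<subseteq> {1..N}"
    and q_pos: "0 < q" and q_half: "q < 1/2"
begin

abbreviation "ev \<equiv> evidence N q S \<pi>"
abbreviation "post \<equiv> bayes N q S \<pi>"
abbreviation "qmass \<equiv> mass \<pi> S"

abbreviation "expec \<equiv> expected_update N q S \<pi>"

lemma expec_def: "expec \<phi> = ev True * \<phi> (post True) + ev False * \<phi> (post False)"
  by (simp add: expected_update_def UNIV_bool)

lemma sum_lkl:
  assumes "J \<subseteq> {1..N}"
  shows "(\<Sum>i\<in>J. \<pi> i * lkl q S i True) = q * mass \<pi> J + (1 - 2*q) * mass \<pi> (J \<inter> S)"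
    and "(\<Sum>i\<in>J. \<pi> i * lkl q S i False) = (1 - q) * mass \<pi> J - (1 - 2*q) * mass \<pi> (J \<inter> S)"
proof -
  have fin: "finite J" using assms finite_subset by blast
  have JS: "mass \<pi> (J \<inter> S) = (\<Sum>i\<in>J. if i \<in> S then \<pi> i else 0)"
    unfolding mass_def using fin by (simp add: sum.inter_restrict)
  show "(\<Sum>i\<in>J. \<pi> i * lkl q S i True) = q * mass \<pi> J + (1 - 2*q) * mass \<pi> (J \<inter> S)"
    unfolding JS unfolding mass_def sum_distrib_left sum.distrib[symmetric]
    by (intro sum.cong) (auto simp: lkl_def algebra_simps)
  show "(\<Sum>i\<in>J. \<pi> i * lkl q S i False) = (1 - q) * mass \<pi> J - (1 - 2*q) * mass \<pi> (J \<inter> S)"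
    unfolding JS unfolding mass_def sum_distrib_left sum_subtractf[symmetric]
    by (intro sum.cong) (auto simp: lkl_def algebra_simps)
qed

lemma qmass_bounds: "0 \<le> qmass" "qmass \<le> 1"
  using mass_nonneg[OF prob_vec S_sub] mass_le_1[OF prob_vec S_sub] by auto

lemma ev_True: "ev True = q + (1 - 2*q) * qmass"
  and ev_False: "ev False = (1 - q) - (1 - 2*q) * qmass"
proof -
  have "{1..N} \<inter> S = S" "mass \<pi> {1..N} = 1" using S_sub prob_vec by (auto simp: prob_vec_def)
  then show "ev True = q + (1 - 2*q) * qmass" "ev False = (1 - q) - (1 - 2*q) * qmass"
    unfolding evidence_def using sum_lkl[of "{1..N}"] by simp_all
qed

lemma ev_sum: "ev True + ev False = 1"
  by (simp add: ev_True ev_False)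

lemma lkl_pos: "0 < lkl q S i y"
  using q_pos q_half by (auto simp: lkl_def)

lemma lkl_bounds: "q \<le> lkl q S i y" "lkl q S i y \<le> 1 - q"
  using q_half by (auto simp: lkl_def)

lemma ev_pos: "0 < ev y"
proof -
  have "(1 - 2*q) * qmass \<le> (1 - 2*q) * 1" "0 \<le> (1 - 2*q) * qmass"
    using qmass_bounds q_half by (auto intro!: mult_left_mono)
  then show ?thesis using q_pos by (cases y) (auto simp: ev_True ev_False)
qed

lemma ev_le_1: "ev y \<le> 1"
  using ev_sum ev_pos[of True] ev_pos[of False] by (cases y) auto

lemma mass_post: "mass (post y) J = (\<Sum>i\<in>J. \<pi> i * lkl q S i y) / ev y"
  by (simp add: mass_def bayes_def sum_divide_distrib)

lemma prob_vec_post: "prob_vec N (post y)"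
  unfolding prob_vec_def
proof
  show "\<forall>i\<in>{1..N}. 0 < post y i"
    unfolding bayes_def using prob_vec_pos[OF prob_vec] lkl_pos ev_pos by simp
  show "mass (post y) {1..N} = 1"
    unfolding mass_post evidence_def[symmetric] using ev_pos[of y] by simp
qed

lemma expec_mono_const:
  assumes "\<And>y. c \<le> \<phi> (post y)"
  shows "c \<le> expec \<phi>"
proof -
  have "ev True * c + ev False * c \<le> expec \<phi>"
    unfolding expec_def using assms ev_pos by (intro add_mono mult_left_mono) (auto intro: less_imp_le)
  then show ?thesis using ev_sum by (metis distrib_right mult_1)
qed

text \<open>The mass of \<open>J\<close> is a martingale: it moves by \<open>D / ev True\<close> or
  \<open>- D / ev False\<close>, where \<open>D\<close> is \<open>1 - 2*q\<close> times the
  covariance of membership in \<open>J\<close> and in \<open>S\<close>. Its second moment therefore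
  grows by \<open>D\<^sup>2 / ev True + D\<^sup>2 / ev False\<close>, which is at least
  \<open>2 * D\<^sup>2\<close>.\<close>

lemma expec_mass_square:
  assumes "J \<subseteq> {1..N}"
  shows "(mass \<pi> J)\<^sup>2 + 2 * (1 - 2*q)\<^sup>2 * (mass \<pi> (J \<inter> S) - mass \<pi> J * qmass)\<^sup>2
    \<le> expec (\<lambda>\<pi>. (mass \<pi> J)\<^sup>2)"
proof -
  define w D where "w = mass \<pi> J" and "D = (1 - 2*q) * (mass \<pi> (J \<inter> S) - mass \<pi> J * qmass)"
  have T: "mass (post True) J = (ev True * w + D) / ev True"
    unfolding mass_post sum_lkl[OF assms] by (simp add: w_def D_def ev_True algebra_simps)
  have F: "mass (post False) J = (ev False * w - D) / ev False"
    unfolding mass_post sum_lkl[OF assms] by (simp add: w_def D_def ev_False algebra_simps)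
  have sq: "e * ((e * w + d) / e)\<^sup>2 = e * w\<^sup>2 + 2 * w * d + d\<^sup>2 / e" if "0 < e" for e d :: real
    using that by (simp add: power2_eq_square field_simps)
  have "expec (\<lambda>\<pi>. (mass \<pi> J)\<^sup>2) =
      (ev True * w\<^sup>2 + 2 * w * D + D\<^sup>2 / ev True) + (ev False * w\<^sup>2 + 2 * w * (-D) + (-D)\<^sup>2 / ev False)"
    unfolding expec_def T F using sq[OF ev_pos, of True D] sq[OF ev_pos, of False "-D"] by simp
  also have "\<dots> = (ev True + ev False) * w\<^sup>2 + (D\<^sup>2 / ev True + D\<^sup>2 / ev False)"
    by (simp add: algebra_simps)
  also have "\<dots> \<ge> w\<^sup>2 + (D\<^sup>2 / 1 + D\<^sup>2 / 1)"
    unfolding ev_sum using ev_pos ev_le_1 by (intro add_mono divide_left_mono) auto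
  finally show ?thesis by (simp add: w_def D_def power_mult_distrib)
qed

text \<open>The subtracted term is the mutual information between target and answer: entropy of the
  answer minus entropy of the noise.\<close>

lemma expec_entropy:
  "expec (\<lambda>\<pi>. - (\<Sum>i\<in>{1..N}. \<pi> i * ln (\<pi> i))) =
   - (\<Sum>i\<in>{1..N}. \<pi> i * ln (\<pi> i)) - (binent (ev True) - binent q)"
proof -
  have ev_term: "ev y * (- (\<Sum>i\<in>{1..N}. post y i * ln (post y i))) =
      ev y * ln (ev y) - (\<Sum>i\<in>{1..N}. \<pi> i * lkl q S i y * (ln (\<pi> i) + ln (lkl q S i y)))" for y
  proof -
    have "ev y * (- (\<Sum>i\<in>{1..N}. post y i * ln (post y i))) =
        - (\<Sum>i\<in>{1..N}. \<pi> i * lkl q S i y * (ln (\<pi> i) + ln (lkl q S i y) - ln (ev y)))"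
      unfolding mult_minus_right sum_distrib_left neg_equal_iff_equal
    proof (intro sum.cong refl)
      fix i assume "i \<in> {1..N}"
      then show "ev y * (post y i * ln (post y i)) =
          \<pi> i * lkl q S i y * (ln (\<pi> i) + ln (lkl q S i y) - ln (ev y))"
        using prob_vec_pos[OF prob_vec, of i] lkl_pos[of i y] ev_pos[of y]
        by (simp add: bayes_def ln_div ln_mult)
    qed
    also have "\<dots> = ln (ev y) * (\<Sum>i\<in>{1..N}. \<pi> i * lkl q S i y)
        - (\<Sum>i\<in>{1..N}. \<pi> i * lkl q S i y * (ln (\<pi> i) + ln (lkl q S i y)))"
      by (simp add: algebra_simps sum.distrib sum_subtractf sum_distrib_left)
    finally show ?thesis by (simp add: evidence_def)
  qed
  \<comment> \<open>The likelihoods of the two answers are \<open>q\<close> and \<open>1 - q\<close>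
    in some order, so their sum is the same for items inside and outside the query.\<close>
  have lkl_split: "lkl q S i True * (ln (\<pi> i) + ln (lkl q S i True))
      + lkl q S i False * (ln (\<pi> i) + ln (lkl q S i False)) = ln (\<pi> i) - binent q" for i
    by (auto simp: lkl_def binent_def algebra_simps)
  have "expec (\<lambda>\<pi>. - (\<Sum>i\<in>{1..N}. \<pi> i * ln (\<pi> i))) =
      ev True * ln (ev True) + ev False * ln (ev False) -
      (\<Sum>i\<in>{1..N}. \<pi> i * (lkl q S i True * (ln (\<pi> i) + ln (lkl q S i True))
      + lkl q S i False * (ln (\<pi> i) + ln (lkl q S i False))))"
    unfolding expec_def ev_term by (simp add: distrib_left sum.distrib mult.assoc)
  also have "\<dots> = - binent (ev True) - (\<Sum>i\<in>{1..N}. \<pi> i * (ln (\<pi> i) - binent q))"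
  proof -
    have "ev False = 1 - ev True" using ev_sum by simp
    then show ?thesis unfolding lkl_split binent_def by simp
  qed
  also have "(\<Sum>i\<in>{1..N}. \<pi> i * (ln (\<pi> i) - binent q)) =
      (\<Sum>i\<in>{1..N}. \<pi> i * ln (\<pi> i)) - mass \<pi> {1..N} * binent q"
    by (simp add: right_diff_distrib sum_subtractf sum_distrib_right mass_def)
  finally show ?thesis using prob_vec by (simp add: prob_vec_def)
qed

text \<open>\<open>ev True\<close> is a mixture of 1/2, with weight \<open>s\<close>, and of
  \<open>q\<close> or \<open>1 - q\<close>, depending on the side of 1/2 on which
  \<open>qmass\<close> lies; concavity of the entropy does the rest.\<close>

lemma information_lower_bound:
  "(1 - 2 * \<bar>qmass - 1/2\<bar>) * (ln 2 - binent q) \<le> binent (ev True) - binent q"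
proof -
  define s where "s = 1 - 2 * \<bar>qmass - 1/2\<bar>"
  have s: "0 \<le> s" "s \<le> 1" using qmass_bounds by (auto simp: s_def abs_if)
  have "(1 - s) * binent q + s * ln 2 \<le> binent (ev True)"
  proof (cases "qmass \<le> 1/2")
    case True
    then have "ev True = (1 - s) * q + s * (1/2)"
      by (simp add: s_def ev_True algebra_simps)
    then show ?thesis
      using binent_concave[of q "1/2" s] s q_pos q_half by (simp add: binent_half)
  next
    case False
    then have "ev True = (1 - s) * (1 - q) + s * (1/2)"
      by (simp add: s_def ev_True algebra_simps)
    then show ?thesis
      using binent_concave[of "1 - q" "1/2" s] s q_pos q_half
      by (simp add: binent_half binent_commute)
  qed
  then show ?thesis unfolding s_def[symmetric] by (simp add: algebra_simps)
qed

lemma post_compl: 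
  assumes "i \<in> {1..N}"
  shows "1 - post y i = (\<Sum>j\<in>{1..N} - {i}. \<pi> j * lkl q S j y) / ev y"
  using mass_compl[OF prob_vec_post, of "{i}" y] assms by (simp add: mass_post)

text \<open>All likelihoods lie between \<open>q\<close> and \<open>1 - q\<close>, so one answer
  multiplies the odds by at most their ratio. This controls the overshoot at the stopping
  time.\<close>

lemma log_odds_post_le:
  assumes "i \<in> {1..N}" "2 \<le> N"
  shows "ln (post y i / (1 - post y i)) \<le> ln (\<pi> i / (1 - \<pi> i)) + ln ((1 - q) / q)"
proof -
  have \<pi>: "0 < \<pi> i" "\<pi> i < 1"
    using assms prob_vec_pos[OF prob_vec] prob_vec_less_1[OF prob_vec] by auto
  have post: "0 < post y i" "post y i < 1"
    using assms prob_vec_pos[OF prob_vec_post] prob_vec_less_1[OF prob_vec_post] by auto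
  have "q * (1 - \<pi> i) = (\<Sum>j\<in>{1..N} - {i}. \<pi> j * q)"
    using mass_compl[OF prob_vec, of "{i}"] assms
    by (simp add: mass_def sum_distrib_right[symmetric])
  also have "\<dots> \<le> (\<Sum>j\<in>{1..N} - {i}. \<pi> j * lkl q S j y)"
    using prob_vec_pos[OF prob_vec] by (intro sum_mono mult_left_mono lkl_bounds) (auto intro: less_imp_le)
  finally have "q * (1 - \<pi> i) / ev y \<le> 1 - post y i"
    unfolding post_compl[OF assms(1)] using ev_pos[of y] by (intro divide_right_mono) auto
  moreover have "post y i \<le> \<pi> i * (1 - q) / ev y"
    unfolding bayes_def using \<pi> lkl_bounds[of i y] ev_pos[of y]
    by (intro divide_right_mono mult_left_mono) auto
  ultimately have "post y i / (1 - post y i) \<le> (\<pi> i * (1 - q) / ev y) / (q * (1 - \<pi> i) / ev y)"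
    using \<pi> q_pos q_half ev_pos[of y] by (intro frac_le) auto
  also have "\<dots> = (\<pi> i / (1 - \<pi> i)) * ((1 - q) / q)"
    using ev_pos[of y] by (simp add: mult.commute[of q])
  finally have "ln (post y i / (1 - post y i)) \<le> ln ((\<pi> i / (1 - \<pi> i)) * ((1 - q) / q))"
    using post \<pi> q_pos q_half by (subst ln_le_cancel_iff) auto
  also have "\<dots> = ln (\<pi> i / (1 - \<pi> i)) + ln ((1 - q) / q)"
    using \<pi> q_pos q_half by (subst ln_mult) auto
  finally show ?thesis .
qed

text \<open>All items other than \<open>d\<close> share one likelihood, so the odds of
  \<open>d\<close> are multiplied by exactly the likelihood ratio.\<close>

lemma log_odds_post_singleton:
  assumes "S = {d}" "2 \<le> N"
  shows "ln (post y d / (1 - post y d)) =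
    ln (\<pi> d / (1 - \<pi> d)) + (if y then 1 else - 1) * ln ((1 - q) / q)"
proof -
  have d: "d \<in> {1..N}" using S_sub assms by auto
  have \<pi>: "0 < \<pi> d" "\<pi> d < 1"
    using assms d prob_vec_pos[OF prob_vec] prob_vec_less_1[OF prob_vec] by auto
  define l0 l1 where "l0 = (if y then q else 1 - q)" and "l1 = (if y then 1 - q else q)"
  have "(\<Sum>j\<in>{1..N} - {d}. \<pi> j * lkl q S j y) = (\<Sum>j\<in>{1..N} - {d}. \<pi> j * l0)"
    using assms by (intro sum.cong) (auto simp: lkl_def l0_def)
  also have "\<dots> = (1 - \<pi> d) * l0"
    using mass_compl[OF prob_vec, of "{d}"] d by (simp add: mass_def sum_distrib_right[symmetric])
  finally have "1 - post y d = (1 - \<pi> d) * l0 / ev y"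
    using post_compl[OF d] by simp
  moreover have "post y d = \<pi> d * l1 / ev y"
    using assms by (simp add: bayes_def lkl_def l1_def)
  ultimately have odds: "post y d / (1 - post y d) = \<pi> d / (1 - \<pi> d) * (l1 / l0)"
    using ev_pos[of y] by simp
  have "ln (post y d / (1 - post y d)) = ln (\<pi> d / (1 - \<pi> d)) + ln (l1 / l0)"
    unfolding odds using \<pi> q_pos q_half by (subst ln_mult) (auto simp: l0_def l1_def)
  also have "ln (l1 / l0) = (if y then 1 else - 1) * ln ((1 - q) / q)"
    using q_pos q_half by (simp add: l0_def l1_def ln_div)
  finally show ?thesis .
qed

end

subsection \<open>The dyadic query\<close>

lemma dyblock_sub: "m < 2^l \<Longrightarrow> l \<le> L \<Longrightarrow> dyblock L l m \<subseteq> {1..2^L}"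
proof -
  assume "m < 2^l" "l \<le> L"
  then have "(m + 1) * 2^(L - l) \<le> 2^l * 2^(L - l)" by (intro mult_right_mono) auto
  also have "\<dots> = (2::nat)^L" using \<open>l \<le> L\<close> by (simp flip: power_add)
  finally show ?thesis by (auto simp: dyblock_def)
qed

lemma sum_dyblocks:
  assumes "l \<le> L"
  shows "(\<Sum>m<2^l. mass \<pi> (dyblock L l m)) = mass \<pi> {1..2^L}"
proof -
  have "(\<Sum>m<n. sum \<pi> {m * k + 1..(m + 1) * k}) = sum \<pi> {1..n * k}" for n k :: nat
  proof (induction n)
    case (Suc n)
    have "{1..Suc n * k} = {1..n * k} \<union> {n * k + 1..(n + 1) * k}" by auto
    then show ?case using Suc by (simp add: sum.union_disjoint)
  qed simp
  moreover have "2^l * 2^(L - l) = (2::nat)^L" using assms by (simp flip: power_add)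
  ultimately show ?thesis by (simp add: mass_def dyblock_def)
qed

lemma dyblock_full [simp]: "dyblock L L m = {Suc m}"
  by (auto simp: dyblock_def)

text \<open>The dyadic level is at least 1 because the two halves cannot both have mass below 1/2;
  hence the query never contains more than half of the items and the noise level never
  exceeds \<open>p (1/2)\<close>.\<close>

lemma dyaPM_query_cases:
  fixes L :: nat and \<pi> :: "nat \<Rightarrow> real"
  assumes pv: "prob_vec (2^L) \<pi>" and L: "L \<ge> 1"
  obtains ls ms ks where
    "1 \<le> ls" "ls \<le> L" "ms < 2^ls"
    "dyaPM_query L \<pi> = {ms * 2^(L - ls) + 1..ks}"
    "ms * 2^(L - ls) + 1 \<le> ks" "ks \<le> (ms + 1) * 2^(L - ls)"
    "1/2 \<le> mass \<pi> (dyblock L ls ms)"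
    "\<And>m. m < 2^ls \<Longrightarrow> mass \<pi> (dyblock L ls m) \<le> mass \<pi> (dyblock L ls ms)"
    "\<And>l m. ls < l \<Longrightarrow> l \<le> L \<Longrightarrow> m < 2^l \<Longrightarrow> mass \<pi> (dyblock L l m) < 1/2"
    "\<And>k. k \<in> {ms * 2^(L - ls) + 1..2^L} \<Longrightarrow>
       \<bar>mass \<pi> {ms * 2^(L - ls) + 1..ks} - 1/2\<bar> \<le> \<bar>mass \<pi> {ms * 2^(L - ls) + 1..k} - 1/2\<bar>"
proof -
  have bm_ge: "mass \<pi> (dyblock L l m) \<le> blockmax L \<pi> l" if "m < 2^l" for l m
    unfolding blockmax_def using that by (intro Max_ge) auto
  have bm_ex: "\<exists>m<2^l. mass \<pi> (dyblock L l m) = blockmax L \<pi> l" for l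
  proof -
    have "blockmax L \<pi> l \<in> (\<lambda>m. mass \<pi> (dyblock L l m)) ` {..<2^l}"
      unfolding blockmax_def by (intro Max_in) (auto simp: lessThan_empty_iff)
    then show ?thesis by auto
  qed
  define P where "P = (\<lambda>l. l \<le> L \<and> blockmax L \<pi> l \<ge> 1/2)"
  define ls where "ls = (GREATEST l. P l)"
  have P1: "P 1"
  proof -
    have "mass \<pi> (dyblock L 1 0) + mass \<pi> (dyblock L 1 1) = 1"
      using sum_dyblocks[OF L, of \<pi>] pv by (simp add: prob_vec_def lessThan_nat_numeral lessThan_Suc)
    moreover have "mass \<pi> (dyblock L 1 0) \<le> blockmax L \<pi> 1"
      "mass \<pi> (dyblock L 1 1) \<le> blockmax L \<pi> 1"
      by (intro bm_ge; simp)+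
    ultimately show ?thesis unfolding P_def using L by linarith
  qed
  have Pb: "P l \<Longrightarrow> l \<le> L" for l by (simp add: P_def)
  have Pls: "P ls" unfolding ls_def by (rule GreatestI_nat[where P = P, OF P1 Pb])
  have ls_max: "P l \<Longrightarrow> l \<le> ls" for l
    unfolding ls_def by (rule Greatest_le_nat[where P = P, OF _ Pb])
  define R where "R = (\<lambda>m. m < 2^ls \<and> mass \<pi> (dyblock L ls m) = blockmax L \<pi> ls)"
  define ms where "ms = (LEAST m. R m)"
  have Rms: "R ms" unfolding ms_def by (rule LeastI_ex) (use bm_ex[of ls] in \<open>auto simp: R_def\<close>)
  define d E where "d = ms * 2^(L - ls) + 1" and "E = (ms + 1) * 2^(L - ls)"
  have block: "dyblock L ls ms = {d..E}" by (simp add: dyblock_def d_def E_def)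
  have sub: "dyblock L ls ms \<subseteq> {1..2^L}"
    using Rms Pls by (intro dyblock_sub) (auto simp: R_def P_def)
  have dE: "1 \<le> d" "d \<le> E" by (auto simp: d_def E_def)
  with sub have EN: "E \<le> 2^L" by (auto simp: block)
  have half: "1/2 \<le> mass \<pi> {d..E}" using Rms Pls by (simp add: R_def P_def block[symmetric])
  define dev where "dev = (\<lambda>k. \<bar>mass \<pi> {d..k} - 1/2\<bar>)"
  define ks where "ks = (LEAST k. k \<in> {d..2^L} \<and> dev k = Min (dev ` {d..2^L}))"
  have "Min (dev ` {d..2^L}) \<in> dev ` {d..2^L}" using dE EN by (intro Min_in) auto
  then have "\<exists>k. k \<in> {d..2^L} \<and> dev k = Min (dev ` {d..2^L})" by auto
  then have ks: "ks \<in> {d..2^L}" "dev ks = Min (dev ` {d..2^L})"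
    unfolding ks_def by (metis (mono_tags, lifting) LeastI_ex)+
  have dev_min: "dev ks \<le> dev k" if "k \<in> {d..2^L}" for k
    unfolding ks(2) using that by (intro Min_le) auto
  \<comment> \<open>The block has mass at least 1/2 and every further item has positive mass, so an
    endpoint beyond \<open>E\<close> would be strictly worse than \<open>E\<close>.\<close>
  have ksE: "ks \<le> E"
  proof (rule ccontr)
    assume "\<not> ks \<le> E"
    then have "E < ks" by simp
    have "{d..ks} = {d..E} \<union> {E + 1..ks}" using dE \<open>E < ks\<close> by auto
    then have "mass \<pi> {d..ks} = mass \<pi> {d..E} + mass \<pi> {E + 1..ks}"
      by (simp add: mass_def sum.union_disjoint)
    moreover have "0 < mass \<pi> {E + 1..ks}"
      unfolding mass_def using \<open>E < ks\<close> ks(1) pv by (intro sum_pos) (auto simp: prob_vec_def)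
    ultimately have "dev E < dev ks" using half by (simp add: dev_def)
    with dev_min[of E] dE EN show False by simp
  qed
  have query: "dyaPM_query L \<pi> = {d..ks}"
    unfolding dyaPM_query_def Let_def P_def[symmetric] ls_def[symmetric] R_def[symmetric]
      ms_def[symmetric]
    unfolding d_def[symmetric] ks_def[unfolded dev_def, symmetric] by (rule refl)
  have finer: "mass \<pi> (dyblock L l m) < 1/2" if "ls < l" "l \<le> L" "m < 2^l" for l m
    using ls_max[of l] bm_ge[OF that(3)] that by (force simp: P_def)
  have max: "mass \<pi> (dyblock L ls m) \<le> mass \<pi> (dyblock L ls ms)" if "m < 2^ls" for m
    using bm_ge[OF that] Rms by (simp add: R_def)
  show thesis
  proof (rule that)
    show "dyaPM_query L \<pi> = {ms * 2^(L - ls) + 1..ks}" using query by (simp only: d_def)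
    show "ks \<le> (ms + 1) * 2^(L - ls)" using ksE by (simp only: E_def)
    show "ms * 2^(L - ls) + 1 \<le> ks" using ks(1) by (simp add: d_def)
    show "1/2 \<le> mass \<pi> (dyblock L ls ms)" using half by (simp only: block)
    show "1 \<le> ls" "ls \<le> L" "ms < 2^ls" using ls_max[OF P1] Pls Rms by (auto simp: P_def R_def)
  qed (use finer max dev_min in \<open>simp_all only: dev_def d_def\<close>)
qed

subsection \<open>Drift of the potentials\<close>

definition entropy :: "nat \<Rightarrow> (nat \<Rightarrow> real) \<Rightarrow> real" where
  "entropy N \<pi> = - (\<Sum>i\<in>{1..N}. \<pi> i * ln (\<pi> i))"

definition block_sq :: "nat \<Rightarrow> nat \<Rightarrow> (nat \<Rightarrow> real) \<Rightarrow> real" where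
  "block_sq L l \<pi> = (\<Sum>m<2^l. (mass \<pi> (dyblock L l m))\<^sup>2)"

definition max_log_odds :: "nat \<Rightarrow> (nat \<Rightarrow> real) \<Rightarrow> real" where
  "max_log_odds N \<pi> = Max ((\<lambda>i. ln (\<pi> i / (1 - \<pi> i))) ` {1..N})"

lemma entropy_nonneg:
  assumes "prob_vec N \<pi>"
  shows "0 \<le> entropy N \<pi>"
  unfolding entropy_def neg_0_le_iff_le
proof (intro sum_nonpos mult_nonneg_nonpos)
  fix i assume "i \<in> {1..N}"
  then show "0 \<le> \<pi> i" "ln (\<pi> i) \<le> 0"
    using prob_vec_pos[OF assms, of i] prob_vec_le_1[OF assms, of i] by auto
qed

lemma block_sq_le_1:
  assumes "prob_vec (2^L) \<pi>" "l \<le> L"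
  shows "block_sq L l \<pi> \<le> 1"
proof -
  have "block_sq L l \<pi> \<le> (\<Sum>m<2^l. mass \<pi> (dyblock L l m))"
    unfolding block_sq_def
  proof (intro sum_mono)
    fix m :: nat assume "m \<in> {..<2^l}"
    then have "dyblock L l m \<subseteq> {1..2^L}" using assms by (intro dyblock_sub) auto
    then show "(mass \<pi> (dyblock L l m))\<^sup>2 \<le> mass \<pi> (dyblock L l m)"
      using mass_nonneg[OF assms(1)] mass_le_1[OF assms(1)]
      by (simp add: power2_eq_square mult_left_le)
  qed
  then show ?thesis using assms sum_dyblocks[OF assms(2), of \<pi>] by (simp add: prob_vec_def)
qed

lemma block_sq_nonneg: "0 \<le> block_sq L l \<pi>"
  by (simp add: block_sq_def sum_nonneg)

lemma max_log_odds_ge: "i \<in> {1..N} \<Longrightarrow> ln (\<pi> i / (1 - \<pi> i)) \<le> max_log_odds N \<pi>"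
  unfolding max_log_odds_def by (intro Max_ge) auto

lemma max_log_odds_le:
  assumes "1 \<le> N" "\<And>i. i \<in> {1..N} \<Longrightarrow> ln (\<pi> i / (1 - \<pi> i)) \<le> c"
  shows "max_log_odds N \<pi> \<le> c"
  unfolding max_log_odds_def using assms by (intro Max.boundedI) auto

lemma log_odds_mono:
  assumes "0 < a" "a \<le> b" "b < (1::real)"
  shows "ln (a / (1 - a)) \<le> ln (b / (1 - b))"
  using assms by (simp add: frac_le)

section \<open>One-step averages of the potentials under a Bayes update\<close>

context bsc_query
begin

lemma expec_entropy_le:
  "expec (entropy N) \<le> entropy N \<pi> - (1 - 2 * \<bar>qmass - 1/2\<bar>) * (ln 2 - binent q)"
proof -
  have "entropy N = (\<lambda>\<pi>. - (\<Sum>i\<in>{1..N}. \<pi> i * ln (\<pi> i)))" by (simp add: fun_eq_iff entropy_def)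
  then show ?thesis using expec_entropy information_lower_bound by simp
qed

lemma expec_entropy_mono: "expec (entropy N) \<le> entropy N \<pi>"
proof -
  have "0 \<le> 1 - 2 * \<bar>qmass - 1/2\<bar>" using qmass_bounds by (simp add: abs_if)
  moreover have "0 \<le> ln 2 - binent q" using binent_le_ln2 q_pos q_half by simp
  ultimately have "0 \<le> (1 - 2 * \<bar>qmass - 1/2\<bar>) * (ln 2 - binent q)" by (rule mult_nonneg_nonneg)
  then show ?thesis using expec_entropy_le by linarith
qed

text \<open>In the sum of \<open>expec_mass_square\<close> over the blocks all increments are
  nonnegative, so one block correlated with the query is enough.\<close>

lemma expec_block_sq:
  assumes N: "N = 2^L" and l: "l \<le> L" and m: "m < 2^l" and a: "0 \<le> a"
    and gap: "a \<le> \<bar>mass \<pi> (dyblock L l m \<inter> S) - mass \<pi> (dyblock L l m) * qmass\<bar>"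
  shows "block_sq L l \<pi> + 2 * (1 - 2*q)\<^sup>2 * a\<^sup>2 \<le> expec (block_sq L l)"
proof -
  define D where "D = (\<lambda>m. (mass \<pi> (dyblock L l m \<inter> S) - mass \<pi> (dyblock L l m) * qmass)\<^sup>2)"
  have "a\<^sup>2 \<le> D m" unfolding D_def using a gap abs_le_square_iff[of a] by simp
  also have "\<dots> \<le> (\<Sum>m<2^l. D m)"
    using m by (intro member_le_sum) (auto simp: D_def)
  finally have "block_sq L l \<pi> + 2 * (1 - 2*q)\<^sup>2 * a\<^sup>2
      \<le> block_sq L l \<pi> + 2 * (1 - 2*q)\<^sup>2 * (\<Sum>m<2^l. D m)"
    by (intro add_left_mono mult_left_mono) auto
  also have "\<dots> = (\<Sum>m<2^l. (mass \<pi> (dyblock L l m))\<^sup>2 + 2 * (1 - 2*q)\<^sup>2 * D m)"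
    by (simp add: block_sq_def sum.distrib sum_distrib_left)
  also have "\<dots> \<le> (\<Sum>m<2^l. expec (\<lambda>\<pi>. (mass \<pi> (dyblock L l m))\<^sup>2))"
    unfolding D_def using dyblock_sub l N by (intro sum_mono expec_mass_square) auto
  also have "\<dots> = expec (block_sq L l)"
    unfolding expec_def block_sq_def by (simp add: sum.distrib sum_distrib_left)
  finally show ?thesis .
qed

lemma expec_block_sq_mono:
  "N = 2^L \<Longrightarrow> l \<le> L \<Longrightarrow> block_sq L l \<pi> \<le> expec (block_sq L l)"
  using expec_block_sq[of L l 0 0] by simp

text \<open>The log-odds \<open>z\<close> of the top item move by \<open>b\<close> up or down, with
  mean \<open>(ev True - ev False) * b\<close>, which is \<open>(2 * \<pi> d - 1) * C1 q\<close>.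
  Truncation costs nothing: \<open>z\<close> is at least \<open>Z\<close> before the update, and the
  truncated value is only larger afterwards.\<close>

lemma expec_max_log_odds:
  assumes S: "S = {d}" and N: "2 \<le> N" and top: "\<And>j. j \<in> {1..N} \<Longrightarrow> \<pi> j \<le> \<pi> d"
    and d: "Z \<le> ln (\<pi> d / (1 - \<pi> d))"
  shows "max Z (max_log_odds N \<pi>) + (2 * \<pi> d - 1) * C1 q
    \<le> expec (\<lambda>\<pi>. max Z (max_log_odds N \<pi>))"
proof -
  have dN: "d \<in> {1..N}" using S S_sub by auto
  define z b where "z = ln (\<pi> d / (1 - \<pi> d))" and "b = ln ((1 - q) / q)"
  have "max_log_odds N \<pi> \<le> z"
    unfolding z_def using N top dN prob_vec_pos[OF prob_vec] prob_vec_less_1[OF prob_vec]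
    by (intro max_log_odds_le log_odds_mono) auto
  then have "max Z (max_log_odds N \<pi>) + (2 * \<pi> d - 1) * C1 q \<le> z + (2 * \<pi> d - 1) * C1 q"
    using d by (simp add: z_def)
  also have "\<dots> = ev True * (z + b) + ev False * (z - b)"
  proof -
    have "ev True * (z + b) + ev False * (z - b) = (ev True + ev False) * z + (ev True - ev False) * b"
      by (simp add: algebra_simps)
    also have "ev True - ev False = (1 - 2*q) * (2 * qmass - 1)"
      unfolding ev_True ev_False by (simp add: algebra_simps)
    also have "qmass = \<pi> d" using S by simp
    finally show ?thesis using q_pos q_half by (simp add: ev_sum C1_eq b_def)
  qed
  also have "\<dots> \<le> expec (\<lambda>\<pi>. max Z (max_log_odds N \<pi>))"
  proof -
    have "z + b \<le> max Z (max_log_odds N (post True))" "z - b \<le> max Z (max_log_odds N (post False))"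
      using max_log_odds_ge[OF dN, of "post True"] max_log_odds_ge[OF dN, of "post False"]
        log_odds_post_singleton[OF S N] by (auto simp: z_def b_def)
    then show ?thesis
      unfolding expec_def using ev_pos by (intro add_mono mult_left_mono) (auto intro: less_imp_le)
  qed
  finally show ?thesis .
qed

lemma max_log_odds_post_le:
  assumes "2 \<le> N"
  shows "max_log_odds N (post y) \<le> max_log_odds N \<pi> + ln ((1 - q) / q)"
  using assms max_log_odds_ge[of _ N \<pi>] log_odds_post_le[of _ y]
  by (intro max_log_odds_le) (auto, fastforce)

lemma gap_inside: "J \<subseteq> S \<Longrightarrow> mass \<pi> (J \<inter> S) - mass \<pi> J * qmass = mass \<pi> J * (1 - qmass)"
  by (simp add: Int_absorb2 algebra_simps)

lemma gap_outside: "J \<inter> S = {} \<Longrightarrow> mass \<pi> (J \<inter> S) - mass \<pi> J * qmass = - (mass \<pi> J * qmass)"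
  by (simp add: mass_def)

text \<open>The covariance of a set on one side of the query is, up to sign, its mass times the
  query mass or the complementary mass, and both factors are at least 1/4.\<close>

lemma gap_ge:
  assumes J: "J \<subseteq> {1..N}" and Js: "J \<subseteq> S \<or> J \<inter> S = {}" and bal: "\<bar>qmass - 1/2\<bar> \<le> 1/4"
  shows "mass \<pi> J / 4 \<le> \<bar>mass \<pi> (J \<inter> S) - mass \<pi> J * qmass\<bar>"
proof -
  have q: "1/4 \<le> qmass" "1/4 \<le> 1 - qmass" using bal by (auto simp: abs_if split: if_splits)
  note J0 = mass_nonneg[OF prob_vec J]
  have "mass \<pi> J * (1/4) \<le> mass \<pi> J * (1 - qmass)" "mass \<pi> J * (1/4) \<le> mass \<pi> J * qmass"
    using q J0 by (intro mult_left_mono; simp)+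
  then show ?thesis using Js gap_inside[of J] gap_outside[of J] by auto
qed

end

section \<open>Size, balance and alignment of the dyadic query\<close>

lemma dyaPM_query_card:
  assumes "prob_vec (2^L) \<pi>" "L \<ge> 1"
  shows "dyaPM_query L \<pi> \<subseteq> {1..2^L}" "0 < card (dyaPM_query L \<pi>)"
    "2 * card (dyaPM_query L \<pi>) \<le> 2^L"
proof -
  obtain ls ms ks where ls: "1 \<le> ls" "ls \<le> L" "ms < 2^ls"
    and query: "dyaPM_query L \<pi> = {ms * 2^(L - ls) + 1..ks}"
    and ks: "ms * 2^(L - ls) + 1 \<le> ks" "ks \<le> (ms + 1) * 2^(L - ls)"
    using dyaPM_query_cases[OF assms] by metis
  have "dyaPM_query L \<pi> \<subseteq> dyblock L ls ms" using ks by (auto simp: query dyblock_def)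
  also have "\<dots> \<subseteq> {1..2^L}" using ls by (intro dyblock_sub)
  finally show "dyaPM_query L \<pi> \<subseteq> {1..2^L}" .
  show "0 < card (dyaPM_query L \<pi>)" using ks by (simp add: query)
  have "2 * card (dyaPM_query L \<pi>) \<le> 2 * 2^(L - ls)" using ks by (simp add: query)
  also have "\<dots> = 2^(Suc (L - ls))" by simp
  also have "\<dots> \<le> 2^L" using ls by (intro power_increasing) auto
  finally show "2 * card (dyaPM_query L \<pi>) \<le> 2^L" .
qed

text \<open>Let \<open>k\<close> be the first index at which the mass counted from \<open>d\<close>
  reaches 1/2. The deviations at \<open>k - 1\<close> and \<open>k\<close> add up to
  \<open>\<pi> k < \<kappa>\<close>, so the smaller one is at most
  \<open>\<kappa> / 2\<close>.\<close>

lemma dyaPM_query_balanced: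
  assumes pv: "prob_vec (2^L) \<pi>" and L: "L \<ge> 1"
    and small: "\<And>i. i \<in> {1..2^L} \<Longrightarrow> \<pi> i < \<kappa>" and \<kappa>: "\<kappa> \<le> 1/2"
  shows "\<bar>mass \<pi> (dyaPM_query L \<pi>) - 1/2\<bar> \<le> \<kappa> / 2"
proof -
  obtain ls ms ks where ls: "1 \<le> ls" "ls \<le> L" "ms < 2^ls"
    and query: "dyaPM_query L \<pi> = {ms * 2^(L - ls) + 1..ks}"
    and half: "1/2 \<le> mass \<pi> (dyblock L ls ms)"
    and best: "\<And>k. k \<in> {ms * 2^(L - ls) + 1..2^L} \<Longrightarrow>
       \<bar>mass \<pi> {ms * 2^(L - ls) + 1..ks} - 1/2\<bar> \<le> \<bar>mass \<pi> {ms * 2^(L - ls) + 1..k} - 1/2\<bar>"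
    using dyaPM_query_cases[OF pv L] by metis
  define d where "d = ms * 2^(L - ls) + 1"
  define k where "k = (LEAST k. d \<le> k \<and> 1/2 \<le> mass \<pi> {d..k})"
  define E where "E = (ms + 1) * 2^(L - ls)"
  have "dyblock L ls ms \<subseteq> {1..2^L}" using ls by (intro dyblock_sub)
  moreover have block: "dyblock L ls ms = {d..E}" by (simp add: dyblock_def d_def E_def)
  ultimately have dE: "1 \<le> d" "d \<le> E" "E \<le> 2^L" by (auto simp: d_def E_def)
  have E: "d \<le> E \<and> 1/2 \<le> mass \<pi> {d..E}" using half dE by (simp add: block)
  have k: "d \<le> k" "1/2 \<le> mass \<pi> {d..k}" "k \<le> E"
    unfolding k_def using LeastI[of "\<lambda>k. d \<le> k \<and> 1/2 \<le> mass \<pi> {d..k}", OF E]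
      Least_le[of "\<lambda>k. d \<le> k \<and> 1/2 \<le> mass \<pi> {d..k}", OF E] by auto
  \<comment> \<open>The endpoint \<open>k - 1\<close> competes only if it is at least
    \<open>d\<close>; this holds because no single item has mass 1/2.\<close>
  have "k \<noteq> d"
  proof
    assume "k = d"
    then have "1/2 \<le> \<pi> d" using k by simp
    with small[of d] \<kappa> dE show False by auto
  qed
  then have k1: "d \<le> k - 1" "k - 1 < k" using k(1) dE by auto
  then have less: "mass \<pi> {d..k - 1} < 1/2"
    using not_less_Least[of "k - 1" "\<lambda>k. d \<le> k \<and> 1/2 \<le> mass \<pi> {d..k}"] by (simp add: k_def)
  have "{d..k} = insert k {d..k - 1}" using k1 by auto
  then have "mass \<pi> {d..k} = mass \<pi> {d..k - 1} + \<pi> k"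
    using k1 by (simp add: mass_def)
  moreover have "\<pi> k < \<kappa>" using small[of k] k dE by simp
  moreover have "\<bar>mass \<pi> {d..ks} - 1/2\<bar> \<le> \<bar>mass \<pi> {d..k} - 1/2\<bar>"
    "\<bar>mass \<pi> {d..ks} - 1/2\<bar> \<le> \<bar>mass \<pi> {d..k - 1} - 1/2\<bar>"
    using best[of k, folded d_def] best[of "k - 1", folded d_def] k k1 dE by auto
  ultimately show ?thesis unfolding query d_def[symmetric] using k(2) less by linarith
qed

text \<open>An item of mass at least 1/2 is a heavy block of the finest level, so the selected level
  is \<open>L\<close> and the selected block is one item.\<close>

lemma dyaPM_query_singleton:
  assumes pv: "prob_vec (2^L) \<pi>" and L: "L \<ge> 1" and i: "i \<in> {1..2^L}" "1/2 \<le> \<pi> i"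
  obtains d where "dyaPM_query L \<pi> = {d}" "d \<in> {1..2^L}" "1/2 \<le> \<pi> d"
    "\<And>j. j \<in> {1..2^L} \<Longrightarrow> \<pi> j \<le> \<pi> d"
proof -
  obtain ls ms ks where ls: "1 \<le> ls" "ls \<le> L" "ms < 2^ls"
    and query: "dyaPM_query L \<pi> = {ms * 2^(L - ls) + 1..ks}"
    and ks: "ms * 2^(L - ls) + 1 \<le> ks" "ks \<le> (ms + 1) * 2^(L - ls)"
    and half: "1/2 \<le> mass \<pi> (dyblock L ls ms)"
    and top: "\<And>m. m < 2^ls \<Longrightarrow> mass \<pi> (dyblock L ls m) \<le> mass \<pi> (dyblock L ls ms)"
    and finer: "\<And>l m. ls < l \<Longrightarrow> l \<le> L \<Longrightarrow> m < 2^l \<Longrightarrow> mass \<pi> (dyblock L l m) < 1/2"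
    using dyaPM_query_cases[OF pv L] by metis
  have "ls = L"
  proof (rule ccontr)
    assume "ls \<noteq> L"
    then have "mass \<pi> (dyblock L L (i - 1)) < 1/2" using i ls by (intro finer) auto
    then show False using i by simp
  qed
  then have "ks = Suc ms" using ks by simp
  show thesis
  proof
    show "dyaPM_query L \<pi> = {Suc ms}" using \<open>ls = L\<close> \<open>ks = Suc ms\<close> by (simp add: query)
    show "Suc ms \<in> {1..2^L}" using ls \<open>ls = L\<close> by auto
    show "1/2 \<le> \<pi> (Suc ms)" using half \<open>ls = L\<close> by simp
    show "\<pi> j \<le> \<pi> (Suc ms)" if "j \<in> {1..2^L}" for j
      using top[of "j - 1"] that \<open>ls = L\<close> by auto
  qed
qed

text \<open>A query coarser than level \<open>r\<close> starts at a boundary between level-\<open>r\<close> blocks, so it splits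
  at most one of them; that block has mass below 1/2, which leaves a sizeable unsplit block.\<close>

lemma dyaPM_query_coarse:
  assumes pv: "prob_vec (2^L) \<pi>" and L: "L \<ge> 1" and r: "r \<le> L"
    and large: "2^(L - r) < card (dyaPM_query L \<pi>)"
  obtains m where "m < 2^r" "1 / 2^(r + 1) \<le> mass \<pi> (dyblock L r m)"
    "dyblock L r m \<subseteq> dyaPM_query L \<pi> \<or> dyblock L r m \<inter> dyaPM_query L \<pi> = {}"
    "\<bar>mass \<pi> (dyaPM_query L \<pi>) - 1/2\<bar> \<le> 1/4"
proof -
  obtain ls ms ks where ls: "1 \<le> ls" "ls \<le> L" "ms < 2^ls"
    and query: "dyaPM_query L \<pi> = {ms * 2^(L - ls) + 1..ks}"
    and ks: "ms * 2^(L - ls) + 1 \<le> ks" "ks \<le> (ms + 1) * 2^(L - ls)"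
    and finer: "\<And>l m. ls < l \<Longrightarrow> l \<le> L \<Longrightarrow> m < 2^l \<Longrightarrow> mass \<pi> (dyblock L l m) < 1/2"
    using dyaPM_query_cases[OF pv L] by metis
  have "card (dyaPM_query L \<pi>) \<le> 2^(L - ls)" using ks by (simp add: query)
  with large have "(2::nat)^(L - r) < 2^(L - ls)" by (rule less_le_trans)
  then have "L - r < L - ls" by (rule power_less_imp_less_exp[rotated]) simp
  then have lsr: "ls < r" using ls r by simp
  have pi_small: "\<pi> i < 1/2" if "i \<in> {1..2^L}" for i
  proof -
    have "mass \<pi> (dyblock L L (i - 1)) < 1/2" using that lsr r by (intro finer) auto
    then show ?thesis using that by simp
  qed
  have bal: "\<bar>mass \<pi> (dyaPM_query L \<pi>) - 1/2\<bar> \<le> 1/4"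
    using dyaPM_query_balanced[OF pv L, of "1/2"] pi_small by simp
  \<comment> \<open>\<open>K\<close> is the length of a level-\<open>r\<close> block, and the query
    starts with block \<open>n\<close>. Items are counted from 1, so the block containing
    \<open>ks\<close> has index \<open>(ks - 1) div K\<close>; only this one can be cut.\<close>
  define K where "K = (2::nat)^(L - r)"
  define mc where "mc = (ks - 1) div K"
  define n where "n = ms * 2^(r - ls)"
  have K: "K > 0" by (simp add: K_def)
  have start: "ms * 2^(L - ls) = n * K"
    using lsr r by (simp add: n_def K_def flip: power_add)
  have "mc * K + (ks - 1) mod K = ks - 1" by (simp add: mc_def)
  then have mc: "mc * K \<le> ks - 1" "ks - 1 < (mc + 1) * K"
    using mod_less_divisor[OF K, of "ks - 1"] unfolding add_mult_distrib by linarith+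
  have aligned: "dyblock L r m \<subseteq> dyaPM_query L \<pi> \<or> dyblock L r m \<inter> dyaPM_query L \<pi> = {}"
    if neq: "m \<noteq> mc" for m
  proof -
    have block: "dyblock L r m = {m * K + 1..(m + 1) * K}" by (simp add: dyblock_def K_def)
    consider "mc < m" | "m < mc" "m < n" | "m < mc" "n \<le> m" using neq by linarith
    then show ?thesis
    proof cases
      case 1
      then have "(mc + 1) * K \<le> m * K" by (intro mult_right_mono) auto
      then show ?thesis using mc by (auto simp: block query)
    next
      case 2
      then have "(m + 1) * K \<le> n * K" by (intro mult_right_mono) auto
      then show ?thesis by (auto simp: block query start)
    next
      case 3
      then have "(m + 1) * K \<le> mc * K" "n * K \<le> m * K" by (intro mult_right_mono; simp)+
      then show ?thesis using mc by (auto simp: block query start)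
    qed
  qed
  \<comment> \<open>Otherwise the \<open>2^r\<close> blocks have total mass at most 1/2 plus the
    mass of block \<open>mc\<close>, which is below 1/2 because \<open>r\<close> is finer than the
    selected level.\<close>
  have "\<exists>m<2^r. m \<noteq> mc \<and> 1 / 2^(r + 1) \<le> mass \<pi> (dyblock L r m)"
  proof (rule ccontr)
    assume "\<not> ?thesis"
    then have *: "mass \<pi> (dyblock L r m) \<le> 1 / 2^(r + 1)" if "m < 2^r" "m \<noteq> mc" for m
      using that by (metis linear)
    have "mass \<pi> {1..2^L} = (\<Sum>m<2^r. mass \<pi> (dyblock L r m))"
      using sum_dyblocks[OF r] by simp
    also have "\<dots> \<le> (\<Sum>m<2^r. 1 / 2^(r + 1) + (if m = mc then mass \<pi> (dyblock L r mc) else 0))"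
      using * by (intro sum_mono) auto
    also have "\<dots> = 1/2 + (if mc < 2^r then mass \<pi> (dyblock L r mc) else 0)"
      by (simp add: sum.distrib)
    also have "\<dots> < 1"
    proof (cases "mc < 2^r")
      case True
      then show ?thesis using finer[OF lsr r True] by (simp only: if_True)
    qed simp
    finally show False using pv by (simp add: prob_vec_def)
  qed
  then show thesis using that aligned bal by metis
qed

subsection \<open>Histories and the stopping time\<close>

locale dyaPM_search =
  fixes p :: "real \<Rightarrow> real" and L :: nat
  assumes p_range: "\<And>x. x \<in> {0<..<1} \<Longrightarrow> 0 < p x \<and> p x < 1/2"
    and p_mono: "mono_on {0<..<1} p"
    and L: "1 \<le> L"
begin

abbreviation query :: "(nat \<Rightarrow> real) \<Rightarrow> nat set" where
  "query \<equiv> dyaPM_query L"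

definition noise :: "(nat \<Rightarrow> real) \<Rightarrow> real" where
  "noise \<pi> = p (card (query \<pi>) / 2^L)"

lemma p_le: "0 < x \<Longrightarrow> x \<le> y \<Longrightarrow> y < 1 \<Longrightarrow> p x \<le> p y"
  using mono_onD[OF p_mono, of x y] by simp

lemma inverse_pow2: "1 \<le> n \<Longrightarrow> 1 / 2^n \<in> {0<..1/2::real}"
  using power_increasing[of 1 n "2::real"] by (simp add: field_simps)

lemma p_pow2: "1 \<le> n \<Longrightarrow> 0 < p (1 / 2^n) \<and> p (1 / 2^n) < 1/2"
  using inverse_pow2[of n] by (intro p_range) auto

lemma p_half: "0 < p (1/2)" "p (1/2) < 1/2"
  using p_pow2[of 1] by auto

lemma p_least: "0 < p (1 / 2^L)" "p (1 / 2^L) < 1/2"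
  using p_pow2[OF L] by auto

lemma noise_bounds:
  assumes "prob_vec (2^L) \<pi>"
  shows "p (1 / 2^L) \<le> noise \<pi>" "noise \<pi> \<le> p (1/2)"
proof -
  have "1 / 2^L \<le> card (query \<pi>) / (2^L :: real)"
    using dyaPM_query_card(2)[OF assms L] by (simp add: field_simps)
  moreover have "real (2 * card (query \<pi>)) \<le> real (2^L)"
    using dyaPM_query_card(3)[OF assms L] by (subst of_nat_le_iff)
  then have "card (query \<pi>) / (2^L :: real) \<le> 1/2" by (simp add: field_simps)
  moreover have "0 < 1 / (2^L :: real)" by simp
  ultimately show "p (1 / 2^L) \<le> noise \<pi>" "noise \<pi> \<le> p (1/2)"
    unfolding noise_def by (intro p_le; linarith)+
qed

lemma bsc_query:
  assumes "prob_vec (2^L) \<pi>"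
  shows "bsc_query (2^L) (noise \<pi>) (query \<pi>) \<pi>"
  using assms noise_bounds[OF assms] p_half p_least dyaPM_query_card(1)[OF assms L]
  by unfold_locales auto

lemma lik_eq: "lik p L (query \<pi>) i y = lkl (noise \<pi>) (query \<pi>) i y"
  by (simp add: lik_def lkl_def noise_def Let_def)

lemma joint_Cons:
  "joint p L (y # h) i =
     joint p L h i * lkl (noise (posterior p L h)) (query (posterior p L h)) i y"
  by (simp add: posterior_def lik_eq)

lemma joint_pos: "i \<in> {1..2^L} \<Longrightarrow> 0 < joint p L h i"
proof (induction h arbitrary: i)
  case (Cons y h)
  have "prob_vec (2^L) (posterior p L h)"
    unfolding posterior_def normalize_post_def using Cons.IH by (intro prob_vec_normalize(2)) auto
  then interpret bsc_query "2^L" "noise (posterior p L h)" "query (posterior p L h)" "posterior p L h"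
    by (rule bsc_query)
  show ?case unfolding joint_Cons using Cons.IH[OF Cons.prems] lkl_pos by (rule mult_pos_pos)
qed simp

lemma hist_prob_pos: "0 < hist_prob p L h"
  unfolding hist_prob_def using joint_pos by (intro prob_vec_normalize(1)) auto

lemma prob_vec_posterior: "prob_vec (2^L) (posterior p L h)"
  unfolding posterior_def normalize_post_def using joint_pos by (intro prob_vec_normalize(2)) auto

lemma posterior_eq: "posterior p L h i = joint p L h i / hist_prob p L h"
  by (simp add: posterior_def normalize_post_def hist_prob_def)

lemma joint_eq: "joint p L h i = hist_prob p L h * posterior p L h i"
  using hist_prob_pos[of h] by (simp add: posterior_eq)

lemma hist_prob_Nil: "hist_prob p L [] = 1"
  by (simp add: hist_prob_def)

lemma hist_prob_Cons:
  "hist_prob p L (y # h) = hist_prob p L h *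
     evidence (2^L) (noise (posterior p L h)) (query (posterior p L h)) (posterior p L h) y"
  unfolding hist_prob_def[of p L "y # h"] joint_Cons joint_eq[of h] evidence_def
  by (simp add: sum_distrib_left mult.assoc)

lemma posterior_Cons:
  "posterior p L (y # h) =
     bayes (2^L) (noise (posterior p L h)) (query (posterior p L h)) (posterior p L h) y"
  unfolding fun_eq_iff posterior_eq[of "y # h"] joint_Cons joint_eq[of h] hist_prob_Cons bayes_def
  using hist_prob_pos[of h] by simp

lemma hist_prob_split: "hist_prob p L (True # h) + hist_prob p L (False # h) = hist_prob p L h"
proof -
  interpret bsc_query "2^L" "noise (posterior p L h)" "query (posterior p L h)" "posterior p L h"
    by (rule bsc_query[OF prob_vec_posterior])
  show ?thesis unfolding hist_prob_Cons distrib_left[symmetric] ev_sum by simp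
qed

text \<open>Tower property, in the form that \<open>expected_tau_le\<close> asks for: a weighted sum
  over the two extensions of a history.\<close>

lemma hist_prob_drift:
  "hist_prob p L (True # h) * \<phi> (posterior p L (True # h)) +
   hist_prob p L (False # h) * \<phi> (posterior p L (False # h)) =
   hist_prob p L h * expected_update (2^L) (noise (posterior p L h)) (query (posterior p L h))
     (posterior p L h) \<phi>"
  unfolding hist_prob_Cons posterior_Cons expected_update_def
  by (simp add: UNIV_bool algebra_simps)

text \<open>Optional stopping: a function of the history that drops by at least 1 on average at each
  step before \<open>\<tau>\<close> and is nonnegative up to \<open>\<tau>\<close> bounds \<open>E[\<tau>]\<close>.\<close>

lemma expected_tau_le:
  fixes V :: "bool list \<Rightarrow> real"
  assumes V_nonneg: "\<And>h y. \<not> stopped p L \<epsilon> h \<Longrightarrow> 0 \<le> V (y # h)"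
    and drift: "\<And>h. \<not> stopped p L \<epsilon> h \<Longrightarrow>
      hist_prob p L (True # h) * V (True # h) + hist_prob p L (False # h) * V (False # h)
        \<le> hist_prob p L h * (V h - 1)"
    and W: "V [] \<le> W" "0 \<le> W"
  shows "expected_tau p L \<epsilon> \<le> ennreal W"
proof -
  \<comment> \<open>Dropping \<open>k\<close> answers goes back to time \<open>t - k\<close>, so
    \<open>B t\<close> holds the histories with \<tau> \<ge> t and \<open>A t\<close> those with
    \<tau> > t. Then \<open>d t\<close> and \<open>a t\<close> are the probabilities of \<tau> = t
    and \<tau> > t, and \<open>v t\<close> is the expectation of \<open>V\<close> on \<tau> >
    t.\<close>
  define B where "B = (\<lambda>t. {h::bool list. length h = t \<and> (\<forall>k\<in>{1..t}. \<not> stopped p L \<epsilon> (drop k h))})"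
  define A where "A = (\<lambda>t. B t \<inter> {h. \<not> stopped p L \<epsilon> h})"
  define d where "d = prob_tau_eq p L \<epsilon>"
  define a where "a = (\<lambda>t. \<Sum>h\<in>A t. hist_prob p L h)"
  define v where "v = (\<lambda>t. \<Sum>h\<in>A t. hist_prob p L h * V h)"
  have finB: "finite (B t)" for t
    using finite_lists_length_eq[of "UNIV :: bool set" t] by (rule finite_subset[rotated]) (auto simp: B_def)
  then have finA: "finite (A t)" for t by (simp add: A_def)
  have B0: "B 0 = {[]}" by (auto simp: B_def)
  have B_Suc: "B (Suc t) = (Cons True ` A t) \<union> (Cons False ` A t)" for t
  proof -
    have range: "{1..Suc t} = insert 1 (Suc ` {1..t})"
      by (simp add: image_Suc_atLeastAtMost atLeastAtMost_insertL)
    have "y # h \<in> B (Suc t) \<longleftrightarrow> h \<in> A t" for y h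
      unfolding A_def B_def range ball_simps Int_iff mem_Collect_eq by auto
    moreover have "h \<in> B (Suc t) \<Longrightarrow> h \<noteq> []" for h
      by (auto simp: B_def)
    ultimately have "h \<in> B (Suc t) \<longleftrightarrow> h \<in> Cons True ` A t \<union> Cons False ` A t" for h
      by (cases h; cases "hd h") auto
    then show ?thesis by blast
  qed
  have sum_B: "(\<Sum>h\<in>B (Suc t). f h) = (\<Sum>h\<in>A t. f (True # h) + f (False # h))" for f :: "bool list \<Rightarrow> real" and t
    unfolding B_Suc using finA by (subst sum.union_disjoint) (auto simp: sum.reindex sum.distrib)
  have d_eq: "d t = (\<Sum>h\<in>B t - A t. hist_prob p L h)" for t
    unfolding d_def prob_tau_eq_def by (intro sum.cong) (auto simp: A_def B_def)
  have split: "(\<Sum>h\<in>B t. hist_prob p L h) = d t + a t" for t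
    unfolding d_eq a_def using finB by (intro sum.subset_diff) (auto simp: A_def)
  have d0: "d 0 + a 0 = 1"
    using split[of 0] by (simp add: B0 hist_prob_Nil)
  have d_Suc: "d (Suc t) = a t - a (Suc t)" for t
    using split[of "Suc t"] unfolding sum_B by (simp add: hist_prob_split a_def)
  have d_nonneg: "0 \<le> d t" and a_nonneg: "0 \<le> a t" for t
    unfolding d_eq a_def using less_imp_le[OF hist_prob_pos] by (simp_all add: sum_nonneg)
  have V_B: "0 \<le> hist_prob p L h * V h" if "h \<in> B (Suc t)" for h t
    using that V_nonneg hist_prob_pos[of h] unfolding B_Suc
    by (intro mult_nonneg_nonneg) (auto simp: A_def intro: less_imp_le)
  have v_nonneg: "0 \<le> v (Suc t)" for t
    unfolding v_def using V_B[of _ t] by (intro sum_nonneg) (auto simp: A_def)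
  have v_Suc: "v (Suc t) \<le> v t - a t" for t
  proof -
    have "v (Suc t) \<le> (\<Sum>h\<in>B (Suc t). hist_prob p L h * V h)"
      unfolding v_def using finB V_B[of _ t] by (intro sum_mono2) (auto simp: A_def)
    also have "\<dots> \<le> (\<Sum>h\<in>A t. hist_prob p L h * (V h - 1))"
      unfolding sum_B using drift by (intro sum_mono) (auto simp: A_def)
    also have "\<dots> = v t - a t"
      by (simp add: v_def a_def right_diff_distrib sum_subtractf)
    finally show ?thesis .
  qed
  \<comment> \<open>If the empty history is already stopped, \<open>v 0\<close> is an empty sum and
    \<open>0 \<le> W\<close> is what counts.\<close>
  have v0: "v 0 \<le> W"
  proof -
    have "A 0 = {} \<or> A 0 = {[]}" unfolding A_def B0 by blast
    then show ?thesis
    proof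
      assume "A 0 = {[]}"
      then have "v 0 = V []" by (simp add: v_def hist_prob_Nil)
      then show ?thesis using W(1) by (simp only:)
    qed (use W(2) in \<open>simp add: v_def\<close>)
  qed
  \<comment> \<open>Telescoping of \<open>v\<close>. The case \<open>n = 0\<close> is separate
    because \<open>V\<close> is known to be nonnegative only after a step.\<close>
  have sum_a: "(\<Sum>t<n. a t) \<le> W" for n
  proof (cases n)
    case (Suc m)
    have "(\<Sum>t<n. a t) + v n \<le> v 0" for n
    proof (induction n)
      case (Suc n)
      then show ?case using v_Suc[of n] by simp
    qed simp
    from this[of n] show ?thesis using v_nonneg[of m] v0 Suc by simp
  qed (use W in simp)
  \<comment> \<open>Summation by parts, since \<open>d\<close> is the decrement of the tail
    \<open>a\<close>.\<close>
  have sum_td: "(\<Sum>t<Suc n. real t * d t) = (\<Sum>t<n. a t) - real n * a n" for n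
    by (induction n) (simp_all add: d_Suc algebra_simps)
  have sum_d: "(\<Sum>t<Suc n. d t) = 1 - a n" for n
    by (induction n) (use d0 in \<open>simp_all add: d_Suc\<close>)
  have "(\<Sum>t. of_nat t * ennreal (d t)) \<le> ennreal W"
  proof (rule suminf_le_const)
    fix n
    have "(\<Sum>t<n. of_nat t * ennreal (d t)) \<le> (\<Sum>t<Suc n. of_nat t * ennreal (d t))"
      by (intro sum_mono2) auto
    also have "\<dots> = ennreal (\<Sum>t<Suc n. real t * d t)"
      using d_nonneg by (subst sum_ennreal[symmetric]) (auto simp: ennreal_mult ennreal_of_nat_eq_real_of_nat)
    also have "\<dots> \<le> ennreal W"
      unfolding sum_td using sum_a[of n] a_nonneg[of n] by (intro ennreal_leI) (smt (verit) mult_nonneg_nonneg of_nat_0_le_iff)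
    finally show "(\<Sum>t<n. of_nat t * ennreal (d t)) \<le> ennreal W" .
  qed simp
  \<comment> \<open>If \<tau> were infinite with probability \<open>1 - s > 0\<close>, each tail
    \<open>a n\<close> would be at least \<open>1 - s\<close>, against the bound on their
    sum.\<close>
  moreover have "\<not> (\<Sum>t. ennreal (d t)) < 1"
  proof
    assume less: "(\<Sum>t. ennreal (d t)) < 1"
    define s where "s = enn2real (\<Sum>t. ennreal (d t))"
    have s: "(\<Sum>t. ennreal (d t)) = ennreal s"
      unfolding s_def using less by (intro ennreal_enn2real[symmetric]) (auto intro: less_trans)
    have "0 \<le> s" by (simp add: s_def)
    then have "s < 1" using less unfolding s by (simp add: ennreal_less_one_iff)
    have "1 - s \<le> a n" for n
    proof -
      have "ennreal (1 - a n) \<le> ennreal s"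
      proof -
        have "ennreal (1 - a n) = (\<Sum>t<Suc n. ennreal (d t))"
          unfolding sum_d[symmetric] using d_nonneg by (intro sum_ennreal[symmetric])
        also have "\<dots> \<le> (\<Sum>t. ennreal (d t))" by (intro sum_le_suminf) auto
        finally show ?thesis by (simp only: s)
      qed
      then show ?thesis using \<open>0 \<le> s\<close> by (simp add: ennreal_le_iff)
    qed
    then have "real n * (1 - s) \<le> W" for n
      using sum_bounded_below[of "{..<n}" "1 - s" a] sum_a[of n] by simp
    moreover obtain n where "W < real n * (1 - s)"
      using \<open>s < 1\<close> reals_Archimedean3[of "1 - s"] by auto
    ultimately show False by (metis not_le)
  qed
  ultimately show ?thesis by (simp add: expected_tau_def d_def)
qed

end

subsection \<open>The Lyapunov function\<close>

locale dyaPM_lyapunov = dyaPM_search +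
  fixes \<kappa> :: real and r :: nat
  assumes \<kappa>: "0 < \<kappa>" "\<kappa> \<le> 1/4"
    and r: "1 \<le> r" "r \<le> L"
begin

text \<open>Worst cases: a query mass \<open>\<kappa> / 2\<close> away from 1/2 for
  \<open>rate_far\<close>; covariance \<open>\<kappa>\<^sup>2\<close> or
  \<open>1 / 2^(r + 3)\<close> with the query, at the largest noise \<open>p (1/2)\<close>, for
  \<open>rate_mid\<close> and \<open>rate_coarse\<close>; a top mass \<open>1 - \<kappa>\<close> for
  \<open>rate_near\<close>. \<open>level\<close> is the log-odds of mass
  \<open>1 - \<kappa>\<close>, and \<open>overshoot\<close> bounds the growth of log-odds in one
  step.\<close>

definition "rate_far = (1 - \<kappa>) * mutual_info_bsc (1/2) (p (1 / 2^r))"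
definition "rate_mid = 2 * (1 - 2 * p (1/2))\<^sup>2 * (\<kappa>\<^sup>2)\<^sup>2"
definition "rate_coarse = 2 * (1 - 2 * p (1/2))\<^sup>2 * (1 / 2^(r + 3))\<^sup>2"
definition "rate_near = (1 - 2*\<kappa>) * C1 (p (1 / 2^L))"
definition "level = ln ((1 - \<kappa>) / \<kappa>)"
definition "overshoot = ln ((1 - p (1 / 2^L)) / p (1 / 2^L))"

text \<open>The summands lose at least 1 per step in the far, intermediate, coarse and near states,
  respectively, and never increase on average.\<close>

definition lyapunov :: "real \<Rightarrow> (nat \<Rightarrow> real) \<Rightarrow> real" where
  "lyapunov \<epsilon> \<pi> =
     entropy (2^L) \<pi> / rate_far
     + (1 - block_sq L L \<pi>) / rate_mid
     + (1 - block_sq L r \<pi>) / rate_coarse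
     + (level + ln (1 / \<epsilon>) + overshoot - max level (max_log_odds (2^L) \<pi>)) / rate_near"

lemma two_le: "(2::nat) \<le> 2^L"
  using power_increasing[of 1 L "2::nat"] L by simp

lemma rates_pos: "0 < rate_far" "0 < rate_mid" "0 < rate_coarse" "0 < rate_near"
proof -
  show "0 < rate_far"
    unfolding rate_far_def using \<kappa> p_pow2[OF r(1)]
    by (intro mult_pos_pos mutual_info_bsc_half_pos) auto
  have "0 < (1 - 2 * p (1/2))\<^sup>2" using p_half by simp
  then show "0 < rate_mid" "0 < rate_coarse"
    unfolding rate_mid_def rate_coarse_def using \<kappa> by simp_all
  show "0 < rate_near"
    unfolding rate_near_def using \<kappa> p_least by (intro mult_pos_pos C1_pos) auto
qed

lemma level_nonneg: "0 \<le> level"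
  unfolding level_def using \<kappa> by (intro log_ratio_nonneg) auto

lemma overshoot_nonneg: "0 \<le> overshoot"
  unfolding overshoot_def using p_least by (intro log_ratio_nonneg) auto

section \<open>Drift in each kind of state\<close>

lemma noise_gap:
  assumes "prob_vec (2^L) \<pi>"
  shows "2 * (1 - 2 * p (1/2))\<^sup>2 * a\<^sup>2 \<le> 2 * (1 - 2 * noise \<pi>)\<^sup>2 * a\<^sup>2"
  using noise_bounds(2)[OF assms] p_half by (intro mult_right_mono mult_left_mono power_mono) auto

text \<open>The size of the query bounds the noise by \<open>p (1 / 2^r)\<close>, and small masses
  make the query nearly balanced; each bounds one factor of the information gain.\<close>

lemma far_drift:
  assumes pv: "prob_vec (2^L) \<pi>"
    and small: "\<And>i. i \<in> {1..2^L} \<Longrightarrow> \<pi> i < \<kappa>"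
    and fine: "card (query \<pi>) \<le> 2^(L - r)"
  shows "expected_update (2^L) (noise \<pi>) (query \<pi>) \<pi> (entropy (2^L)) \<le> entropy (2^L) \<pi> - rate_far"
proof -
  interpret bsc_query "2^L" "noise \<pi>" "query \<pi>" \<pi> by (rule bsc_query[OF pv])
  have "real (card (query \<pi>)) \<le> real (2^(L - r))" using fine by (subst of_nat_le_iff)
  then have "card (query \<pi>) / 2^L \<le> 2^(L - r) / (2^L :: real)" by (simp add: divide_right_mono)
  also have "\<dots> = 1 / 2^r" using r by (simp add: power_diff)
  finally have "noise \<pi> \<le> p (1 / 2^r)"
    unfolding noise_def using inverse_pow2[OF r(1)] dyaPM_query_card(2)[OF pv L]
    by (intro p_le) auto
  then have I: "mutual_info_bsc (1/2) (p (1 / 2^r)) \<le> ln 2 - binent (noise \<pi>)"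
    using mutual_info_bsc_half_antimono[of "noise \<pi>" "p (1 / 2^r)"] q_pos q_half p_pow2[OF r(1)]
    by (simp add: mutual_info_bsc_half)
  have "\<bar>qmass - 1/2\<bar> \<le> \<kappa> / 2"
    using \<kappa> by (intro dyaPM_query_balanced[OF pv L small]) auto
  then have "rate_far \<le> (1 - 2 * \<bar>qmass - 1/2\<bar>) * (ln 2 - binent (noise \<pi>))"
    unfolding rate_far_def using I \<kappa> mutual_info_bsc_half_pos[of "p (1 / 2^r)"] p_pow2[OF r(1)]
    by (intro mult_mono) auto
  then show ?thesis using expec_entropy_le by linarith
qed

text \<open>Some item has covariance at least \<open>\<kappa>\<^sup>2\<close> with the query. If an
  item has mass at least 1/2, the query is a single \<open>d\<close>, with covariance
  \<open>\<pi> d * (1 - \<pi> d)\<close>. Otherwise the query is balanced and item \<open>i\<close>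
  has covariance at least \<open>\<kappa> / 4\<close>.\<close>

lemma mid_drift:
  assumes pv: "prob_vec (2^L) \<pi>"
    and i: "i \<in> {1..2^L}" "\<kappa> \<le> \<pi> i"
    and le: "\<And>j. j \<in> {1..2^L} \<Longrightarrow> \<pi> j \<le> 1 - \<kappa>"
  shows "block_sq L L \<pi> + rate_mid
    \<le> expected_update (2^L) (noise \<pi>) (query \<pi>) \<pi> (block_sq L L)"
proof -
  interpret bsc_query "2^L" "noise \<pi>" "query \<pi>" \<pi> by (rule bsc_query[OF pv])
  have "\<exists>j\<in>{1..2^L}. \<kappa>\<^sup>2 \<le> \<bar>mass \<pi> ({j} \<inter> query \<pi>) - mass \<pi> {j} * qmass\<bar>"
  proof (cases "\<exists>j\<in>{1..2^L}. 1/2 \<le> \<pi> j")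
    case True
    then obtain d where d: "query \<pi> = {d}" "d \<in> {1..2^L}" "1/2 \<le> \<pi> d"
      using dyaPM_query_singleton[OF pv L] by metis
    have "\<kappa> * \<kappa> \<le> \<pi> d * (1 - \<pi> d)"
      using d \<kappa> le[OF d(2)] by (intro mult_mono) auto
    then have "\<kappa>\<^sup>2 \<le> \<bar>mass \<pi> ({d} \<inter> query \<pi>) - mass \<pi> {d} * qmass\<bar>"
      using d by (simp add: power2_eq_square algebra_simps)
    with d(2) show ?thesis by blast
  next
    case False
    then have "\<bar>qmass - 1/2\<bar> \<le> 1/4"
      using dyaPM_query_balanced[OF pv L, of "1/2"] by (simp add: not_le)
    then have "\<pi> i / 4 \<le> \<bar>mass \<pi> ({i} \<inter> query \<pi>) - mass \<pi> {i} * qmass\<bar>"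
      using gap_ge[of "{i}"] i by auto
    moreover have "\<kappa> * \<kappa> \<le> \<pi> i * (1/4)" using \<kappa> i by (intro mult_mono) auto
    ultimately have "\<kappa>\<^sup>2 \<le> \<bar>mass \<pi> ({i} \<inter> query \<pi>) - mass \<pi> {i} * qmass\<bar>"
      unfolding power2_eq_square by linarith
    with i(1) show ?thesis by blast
  qed
  then obtain j where j: "j \<in> {1..2^L}"
    "\<kappa>\<^sup>2 \<le> \<bar>mass \<pi> ({j} \<inter> query \<pi>) - mass \<pi> {j} * qmass\<bar>" by blast
  have "block_sq L L \<pi> + rate_mid \<le> block_sq L L \<pi> + 2 * (1 - 2 * noise \<pi>)\<^sup>2 * (\<kappa>\<^sup>2)\<^sup>2"
    unfolding rate_mid_def by (intro add_left_mono noise_gap[OF pv])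
  also have "\<dots> \<le> expec (block_sq L L)"
    using j by (intro expec_block_sq[where m = "j - 1"]) auto
  finally show ?thesis .
qed

lemma coarse_drift:
  assumes pv: "prob_vec (2^L) \<pi>" and large: "2^(L - r) < card (query \<pi>)"
  shows "block_sq L r \<pi> + rate_coarse
    \<le> expected_update (2^L) (noise \<pi>) (query \<pi>) \<pi> (block_sq L r)"
proof -
  interpret bsc_query "2^L" "noise \<pi>" "query \<pi>" \<pi> by (rule bsc_query[OF pv])
  obtain m where m: "m < 2^r" "1 / 2^(r + 1) \<le> mass \<pi> (dyblock L r m)"
    "dyblock L r m \<subseteq> query \<pi> \<or> dyblock L r m \<inter> query \<pi> = {}" "\<bar>qmass - 1/2\<bar> \<le> 1/4"
    using dyaPM_query_coarse[OF pv L r(2) large] by metis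
  have "1 / 2^(r + 3) \<le> mass \<pi> (dyblock L r m) / 4"
    using m(2) by (simp add: power_add)
  also have "\<dots> \<le> \<bar>mass \<pi> (dyblock L r m \<inter> query \<pi>) - mass \<pi> (dyblock L r m) * qmass\<bar>"
    using m r by (intro gap_ge dyblock_sub) auto
  finally have gap: "1 / 2^(r + 3) \<le> \<dots>" .
  have "block_sq L r \<pi> + rate_coarse
      \<le> block_sq L r \<pi> + 2 * (1 - 2 * noise \<pi>)\<^sup>2 * (1 / 2^(r + 3))\<^sup>2"
    unfolding rate_coarse_def by (intro add_left_mono noise_gap[OF pv])
  also have "\<dots> \<le> expec (block_sq L r)"
    using m r gap by (intro expec_block_sq[where m = m]) auto
  finally show ?thesis .
qed

text \<open>The query is the heaviest item alone, so the noise is \<open>p (1 / 2^L)\<close>; its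
  mass exceeds \<open>1 - \<kappa>\<close>, hence \<open>2 * \<pi> d - 1\<close> exceeds
  \<open>1 - 2*\<kappa>\<close>.\<close>

lemma near_drift:
  assumes pv: "prob_vec (2^L) \<pi>" and i: "i \<in> {1..2^L}" "1 - \<kappa> < \<pi> i"
  shows "max level (max_log_odds (2^L) \<pi>) + rate_near
    \<le> expected_update (2^L) (noise \<pi>) (query \<pi>) \<pi> (\<lambda>\<pi>. max level (max_log_odds (2^L) \<pi>))"
proof -
  interpret bsc_query "2^L" "noise \<pi>" "query \<pi>" \<pi> by (rule bsc_query[OF pv])
  have "1/2 \<le> \<pi> i" using i \<kappa> by simp
  then obtain d where d: "query \<pi> = {d}" "d \<in> {1..2^L}"
    and top: "\<And>j. j \<in> {1..2^L} \<Longrightarrow> \<pi> j \<le> \<pi> d"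
    using dyaPM_query_singleton[OF pv L i(1)] by metis
  have \<pi>d: "1 - \<kappa> < \<pi> d" using i top by fastforce
  have q: "noise \<pi> = p (1 / 2^L)" using d by (simp add: noise_def)
  have "level \<le> ln (\<pi> d / (1 - \<pi> d))"
    using log_odds_mono[of "1 - \<kappa>" "\<pi> d"] \<kappa> \<pi>d prob_vec_less_1[OF pv d(2) two_le]
    by (simp add: level_def)
  moreover have "rate_near \<le> (2 * \<pi> d - 1) * C1 (noise \<pi>)"
    unfolding rate_near_def q using \<pi>d C1_pos[OF p_least] by (intro mult_right_mono) auto
  ultimately show ?thesis using expec_max_log_odds[OF d(1) two_le top] by fastforce
qed

text \<open>Away from near states the truncated log-odds sit at their minimum \<open>level\<close>
  and cannot decrease; this is the purpose of the truncation.\<close>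

lemma level_mono:
  assumes pv: "prob_vec (2^L) \<pi>"
  shows "max level (max_log_odds (2^L) \<pi>)
    \<le> expected_update (2^L) (noise \<pi>) (query \<pi>) \<pi> (\<lambda>\<pi>. max level (max_log_odds (2^L) \<pi>))"
proof (cases "\<exists>i\<in>{1..2^L}. 1 - \<kappa> < \<pi> i")
  case True
  then show ?thesis using near_drift[OF pv] rates_pos(4) by fastforce
next
  case False
  interpret bsc_query "2^L" "noise \<pi>" "query \<pi>" \<pi> by (rule bsc_query[OF pv])
  have "max_log_odds (2^L) \<pi> \<le> level"
  proof (rule max_log_odds_le)
    fix i :: nat assume "i \<in> {1..2^L}"
    then have "ln (\<pi> i / (1 - \<pi> i)) \<le> ln ((1 - \<kappa>) / (1 - (1 - \<kappa>)))"
      using False \<kappa> prob_vec_pos[OF pv, of i] by (intro log_odds_mono) (auto simp: not_less)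
    then show "ln (\<pi> i / (1 - \<pi> i)) \<le> level" by (simp add: level_def)
  qed simp
  then show ?thesis using expec_mono_const[of level "\<lambda>\<pi>. max level (max_log_odds (2^L) \<pi>)"] by simp
qed

lemma lyapunov_drift:
  assumes pv: "prob_vec (2^L) \<pi>"
  shows "expected_update (2^L) (noise \<pi>) (query \<pi>) \<pi> (lyapunov \<epsilon>) \<le> lyapunov \<epsilon> \<pi> - 1"
proof -
  interpret bsc_query "2^L" "noise \<pi>" "query \<pi>" \<pi> by (rule bsc_query[OF pv])
  define F where "F = (\<lambda>\<pi>. max level (max_log_odds (2^L) \<pi>))"
  define H where "H = (entropy (2^L) \<pi> - expec (entropy (2^L))) / rate_far"
  define M where "M = (expec (block_sq L L) - block_sq L L \<pi>) / rate_mid"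
  define C where "C = (expec (block_sq L r) - block_sq L r \<pi>) / rate_coarse"
  define G where "G = (expec F - F \<pi>) / rate_near"
  have nonneg: "0 \<le> H" "0 \<le> M" "0 \<le> C" "0 \<le> G"
    unfolding H_def M_def C_def G_def F_def
    using rates_pos expec_entropy_mono expec_block_sq_mono r level_mono[OF pv] by auto
  \<comment> \<open>The cases may overlap: all four losses are nonnegative on average in every
    state, so one loss of at least 1 suffices.\<close>
  consider "\<forall>i\<in>{1..2^L}. \<pi> i < \<kappa>" "card (query \<pi>) \<le> 2^(L - r)"
    | "2^(L - r) < card (query \<pi>)"
    | i where "i \<in> {1..2^L}" "1 - \<kappa> < \<pi> i"
    | i where "i \<in> {1..2^L}" "\<kappa> \<le> \<pi> i" "\<forall>j\<in>{1..2^L}. \<pi> j \<le> 1 - \<kappa>"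
    by (meson not_le)
  then have "1 \<le> H \<or> 1 \<le> M \<or> 1 \<le> C \<or> 1 \<le> G"
  proof cases
    case 1
    then have "1 \<le> H" using far_drift[OF pv] rates_pos by (simp add: H_def)
    then show ?thesis by simp
  next
    case 2
    then have "1 \<le> C" using coarse_drift[OF pv] rates_pos by (simp add: C_def)
    then show ?thesis by simp
  next
    case 3
    then have "F \<pi> + rate_near \<le> expec F" unfolding F_def by (rule near_drift[OF pv])
    then have "1 \<le> G" using rates_pos by (simp add: G_def)
    then show ?thesis by simp
  next
    case 4
    then have "block_sq L L \<pi> + rate_mid \<le> expec (block_sq L L)" by (intro mid_drift[OF pv]) auto
    then have "1 \<le> M" using rates_pos by (simp add: M_def)
    then show ?thesis by simp
  qed
  moreover have "lyapunov \<epsilon> \<pi> - expec (lyapunov \<epsilon>) = H + M + C + G"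
  proof -
    have F: "ev False = 1 - ev True" using ev_sum by simp
    show ?thesis
      unfolding H_def M_def C_def G_def F_def lyapunov_def expec_def F
      by (simp add: diff_divide_distrib add_divide_distrib algebra_simps)
  qed
  ultimately show ?thesis using nonneg by linarith
qed

text \<open>Before stopping, the log-odds are at most \<open>ln (1 / \<epsilon>)\<close>, and the
  next update adds at most \<open>overshoot\<close>. The summand \<open>level\<close> covers the
  case where the truncation is active.\<close>

lemma lyapunov_nonneg:
  assumes pv: "prob_vec (2^L) \<pi>" and \<epsilon>: "0 < \<epsilon>" "\<epsilon> < 1"
    and unstopped: "\<And>i. i \<in> {1..2^L} \<Longrightarrow> \<pi> i \<le> 1 - \<epsilon>"
  shows "0 \<le> lyapunov \<epsilon> (bayes (2^L) (noise \<pi>) (query \<pi>) \<pi> y)"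
proof -
  interpret bsc_query "2^L" "noise \<pi>" "query \<pi>" \<pi> by (rule bsc_query[OF pv])
  have "max_log_odds (2^L) \<pi> \<le> ln (1 / \<epsilon>)"
  proof (rule max_log_odds_le)
    fix i :: nat assume i: "i \<in> {1..2^L}"
    then have "\<pi> i / (1 - \<pi> i) \<le> 1 / \<epsilon>"
      using unstopped[OF i] prob_vec_le_1[OF pv i] \<epsilon> by (intro frac_le) auto
    then show "ln (\<pi> i / (1 - \<pi> i)) \<le> ln (1 / \<epsilon>)"
      using \<epsilon> i prob_vec_pos[OF pv i] prob_vec_less_1[OF pv i two_le]
      by (subst ln_le_cancel_iff) auto
  qed simp
  moreover have "ln ((1 - noise \<pi>) / noise \<pi>) \<le> overshoot"
    unfolding overshoot_def using noise_bounds[OF pv] p_least q_half by (intro log_ratio_antimono) auto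
  ultimately have "max_log_odds (2^L) (post y) \<le> ln (1 / \<epsilon>) + overshoot"
    using max_log_odds_post_le[OF two_le, of y] by linarith
  moreover have "0 \<le> ln (1 / \<epsilon>)" using \<epsilon> by simp
  ultimately have "max level (max_log_odds (2^L) (post y)) \<le> level + ln (1 / \<epsilon>) + overshoot"
    using level_nonneg overshoot_nonneg by simp
  then show ?thesis
    unfolding lyapunov_def
    using rates_pos entropy_nonneg[OF prob_vec_post] block_sq_le_1[OF prob_vec_post] r
    by (intro add_nonneg_nonneg divide_nonneg_pos) auto
qed

lemma lyapunov_init:
  assumes "0 < \<epsilon>" "\<epsilon> < 1"
  shows "lyapunov \<epsilon> (posterior p L []) \<le> real L * ln 2 / rate_far + 1 / rate_mid + 1 / rate_coarse
    + (ln (1 / \<epsilon>) + overshoot) / rate_near"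
proof -
  have "posterior p L [] i = 1 / 2^L" if "i \<in> {1..2^L}" for i
    using that by (simp add: posterior_eq hist_prob_Nil)
  then have "entropy (2^L) (posterior p L []) = real L * ln 2"
    by (simp add: entropy_def ln_div ln_realpow)
  \<comment> \<open>\<open>level\<close> cancels because the truncated maximum is at least
    \<open>level\<close>.\<close>
  then show ?thesis
    unfolding lyapunov_def using rates_pos block_sq_nonneg
    by (intro add_mono divide_right_mono) (auto intro: less_imp_le)
qed

lemma expected_tau_bound:
  assumes \<epsilon>: "0 < \<epsilon>" "\<epsilon> < 1"
  shows "expected_tau p L \<epsilon> \<le> ennreal (real L * ln 2 / rate_far + 1 / rate_mid + 1 / rate_coarse
    + (ln (1 / \<epsilon>) + overshoot) / rate_near)"
proof (rule expected_tau_le[where V = "\<lambda>h. lyapunov \<epsilon> (posterior p L h)"])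
  fix h y assume "\<not> stopped p L \<epsilon> h"
  then show "0 \<le> lyapunov \<epsilon> (posterior p L (y # h))"
    unfolding posterior_Cons using \<epsilon>
    by (intro lyapunov_nonneg prob_vec_posterior) (auto simp: stopped_def not_less)
next
  fix h
  show "hist_prob p L (True # h) * lyapunov \<epsilon> (posterior p L (True # h)) +
      hist_prob p L (False # h) * lyapunov \<epsilon> (posterior p L (False # h))
      \<le> hist_prob p L h * (lyapunov \<epsilon> (posterior p L h) - 1)"
    unfolding hist_prob_drift using hist_prob_pos[of h]
    by (intro mult_left_mono lyapunov_drift prob_vec_posterior) auto
next
  show "0 \<le> real L * ln 2 / rate_far + 1 / rate_mid + 1 / rate_coarse
    + (ln (1 / \<epsilon>) + overshoot) / rate_near"
    using rates_pos overshoot_nonneg \<epsilon> by (intro add_nonneg_nonneg divide_nonneg_pos) auto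
qed (use lyapunov_init[OF \<epsilon>] in simp)

text \<open>The log-likelihood ratio at noise \<open>p (1 / 2^L)\<close> is a factor of both
  quantities and cancels, so the bound is uniform in \<open>L\<close> even if this noise tends to
  0.\<close>

lemma overshoot_time: "overshoot / rate_near \<le> 2 / (1 - 2 * p (1/2))"
proof (cases "overshoot = 0")
  case False
  with overshoot_nonneg have o: "0 < overshoot" by simp
  have "p (1 / 2^L) \<le> p (1/2)" using inverse_pow2[OF L] by (intro p_le) auto
  then have "(1/2) * (1 - 2 * p (1/2)) \<le> (1 - 2*\<kappa>) * (1 - 2 * p (1 / 2^L))"
    using \<kappa> p_half by (intro mult_mono) auto
  then have "overshoot * (1/2 * (1 - 2 * p (1/2))) \<le> overshoot * ((1 - 2*\<kappa>) * (1 - 2 * p (1 / 2^L)))"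
    using o by (intro mult_left_mono) auto
  also have "\<dots> = rate_near"
    using p_least by (simp add: rate_near_def C1_eq overshoot_def)
  finally show ?thesis using rates_pos(4) p_half by (simp add: field_simps)
qed (use p_half in simp)

end

section \<open>Choice of constants and the asymptotic bound\<close>

theorem theorem3:
  fixes p :: "real \<Rightarrow> real" and l :: real
  assumes p_range: "\<forall>x\<in>{0<..<1}. 0 < p x \<and> p x < 1/2"
    and p_cont: "continuous_on {0<..<1} p"
    and p_mono: "mono_on {0<..<1} p"
    and l_pos: "l > 0"
  shows "K_d p > 0 \<and>
    (\<forall>\<eta>>0. \<exists>M. \<forall>(L::nat) (\<epsilon>::real).
       L \<ge> 1 \<and> 0 < \<epsilon> \<and> \<epsilon> < 1 \<and>
       M \<le> ln (1 / (1 / 2^L * \<epsilon>)) \<and>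
       2 powr (- l) > (exp 1 * ln (1 / (1 / 2^L * \<epsilon>))) powr (- K_d p) \<longrightarrow>
       expected_tau p L \<epsilon> \<le>
         ennreal (ln (1 / (1 / 2^L)) / mutual_info_bsc (1/2) (p (2 powr (- l)))
                  + ln (1 / \<epsilon>) / C1 (p (1 / 2^L))
                  + \<eta> * ln (1 / (1 / 2^L * \<epsilon>))))"
proof (intro conjI allI impI)
  have p_half: "0 < p (1/2)" "p (1/2) < 1/2" using p_range by auto
  then show "K_d p > 0" by (rule K_d_pos)
  fix \<eta> :: real assume \<eta>: "\<eta> > 0"
  define I where "I = mutual_info_bsc (1/2) (p (2 powr (- l)))"
  define I1 where "I1 = mutual_info_bsc (1/2) (p (1/2))"
  define c where "c = C1 (p (1/2))"
  have pl: "0 < (2::real) powr (- l)" "2 powr (- l) < (1::real)" using l_pos by (auto simp: powr_less_one)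
  have I: "I > 0" unfolding I_def using p_range pl by (intro mutual_info_bsc_half_pos) auto
  have I1: "I1 > 0" unfolding I1_def using p_half by (rule mutual_info_bsc_half_pos)
  have c: "c > 0" unfolding c_def using p_half by (rule C1_pos)
  \<comment> \<open>So small that the factors \<open>1 - \<kappa>\<close> and
    \<open>1 - 2*\<kappa>\<close> in the rates cost at most \<open>\<eta> / 4 * X\<close> in
    \<open>far\<close> and \<open>\<eta> / 2 * Y\<close> in \<open>near\<close>.\<close>
  define \<kappa> where "\<kappa> = min (1/4) (\<eta> * min I c / 8)"
  have \<kappa>_small: "0 < \<kappa>" "\<kappa> \<le> 1/4" "\<kappa> \<le> \<eta> * I / 8" "\<kappa> \<le> \<eta> * c / 8"
  proof -
    have "\<eta> * min I c \<le> \<eta> * I" "\<eta> * min I c \<le> \<eta> * c" "0 < \<eta> * min I c"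
      using \<eta> I c by (auto intro!: mult_left_mono mult_pos_pos)
    then show "0 < \<kappa>" "\<kappa> \<le> 1/4" "\<kappa> \<le> \<eta> * I / 8" "\<kappa> \<le> \<eta> * c / 8"
      unfolding \<kappa>_def by linarith+
  qed
  \<comment> \<open>A whole level \<open>R \<ge> l\<close> gives noise at most
    \<open>p (2 powr (- l))\<close>, hence information at least \<open>I\<close>.\<close>
  define R where "R = max 1 (nat \<lceil>l\<rceil>)"
  have R: "1 \<le> R" "l \<le> real R" by (auto simp: R_def) linarith
  define D where "D = 2 * (1 - 2 * p (1/2))\<^sup>2"
  have D: "0 < D" using p_half by (simp add: D_def)
  \<comment> \<open>The costs that do not grow with \<open>L\<close> or
    \<open>1 / \<epsilon>\<close>: far steps when \<open>L < R\<close>, intermediate steps, coarse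
    steps and the overshoot.\<close>
  define W where "W = 2 * real R * ln 2 / I1 + 1 / (D * (\<kappa>\<^sup>2)\<^sup>2) + 1 / (D * (1 / 2^(R + 3))\<^sup>2)
    + 2 / (1 - 2 * p (1/2))"
  show "\<exists>M. \<forall>(L::nat) (\<epsilon>::real).
       L \<ge> 1 \<and> 0 < \<epsilon> \<and> \<epsilon> < 1 \<and>
       M \<le> ln (1 / (1 / 2^L * \<epsilon>)) \<and>
       2 powr (- l) > (exp 1 * ln (1 / (1 / 2^L * \<epsilon>))) powr (- K_d p) \<longrightarrow>
       expected_tau p L \<epsilon> \<le>
         ennreal (ln (1 / (1 / 2^L)) / mutual_info_bsc (1/2) (p (2 powr (- l)))
                  + ln (1 / \<epsilon>) / C1 (p (1 / 2^L))
                  + \<eta> * ln (1 / (1 / 2^L * \<epsilon>)))"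
  proof (intro exI[of _ "2 * W / \<eta>"] allI impI, elim conjE)
    fix L :: nat and \<epsilon> :: real
    assume L: "1 \<le> L" and \<epsilon>: "0 < \<epsilon>" "\<epsilon> < 1" and M: "2 * W / \<eta> \<le> ln (1 / (1 / 2^L * \<epsilon>))"
    define X Y where "X = real L * ln 2" and "Y = ln (1 / \<epsilon>)"
    have XY: "0 \<le> X" "0 \<le> Y" using \<epsilon> by (auto simp: X_def Y_def)
    have ln_delta: "ln (1 / (1 / 2^L)) = X" by (simp add: X_def ln_realpow)
    have ln_prod: "ln (1 / (1 / 2^L * \<epsilon>)) = X + Y"
      using \<epsilon> by (simp add: X_def Y_def ln_realpow ln_div ln_mult)
    \<comment> \<open>The threshold \<open>2 * W / \<eta>\<close> makes \<open>W\<close> at most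
      half of the permitted error.\<close>
    have WM: "W \<le> \<eta> / 2 * (X + Y)" using M \<eta> unfolding ln_prod by (simp add: field_simps)
    define C where "C = C1 (p (1 / 2^L))"
    text \<open>If there is no level-\<open>R\<close> block, then \<open>L\<close> is bounded and level 1, to which every query
      is confined, does as well.\<close>
    define r where "r = (if R \<le> L then R else 1)"
    have r_bounds: "1 \<le> r" "r \<le> L" "r \<le> R" using L R by (auto simp: r_def)
    interpret dyaPM_lyapunov p L \<kappa> r
      using p_range p_mono L \<kappa>_small r_bounds by unfold_locales auto
    have "c \<le> C"
      unfolding c_def C_def using p_least p_half inverse_pow2[OF L]
      by (intro C1_antimono p_le) auto
    then have C: "0 < C" "Y / C \<le> Y / c" using c XY by (auto intro: divide_left_mono)
    have far: "X / rate_far \<le> X / I + \<eta> / 4 * X + 2 * real R * ln 2 / I1"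
    proof (cases "R \<le> L")
      case True
      have "2 powr (- real R) \<le> (2::real) powr (- l)" using R by simp
      then have "1 / 2^r \<le> (2::real) powr (- l)"
        using True by (simp add: r_def powr_minus powr_realpow divide_inverse)
      then have "I \<le> mutual_info_bsc (1/2) (p (1 / 2^r))"
        unfolding I_def using p_pow2[OF r_bounds(1)] p_range pl inverse_pow2[OF r_bounds(1)]
        by (intro mutual_info_bsc_half_antimono p_le) auto
      then have "X / rate_far \<le> X / ((1 - \<kappa>) * I)"
        unfolding rate_far_def using \<kappa>_small I XY by (intro divide_left_mono mult_left_mono mult_pos_pos) auto
      also have "\<dots> = X / I + \<kappa> / (1 - \<kappa>) * (X / I)"
        using \<kappa>_small I by (simp add: field_simps)
      also have "\<kappa> / (1 - \<kappa>) * (X / I) \<le> 2 * \<kappa> * (X / I)"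
        using \<kappa>_small I XY by (intro mult_right_mono) (auto simp: field_simps)
      also have "\<dots> \<le> 2 * (\<eta> * I / 8) * (X / I)"
        using \<kappa>_small I XY by (intro mult_right_mono mult_left_mono) auto
      also have "\<dots> = \<eta> / 4 * X" using I by simp
      finally show ?thesis using I1 by (simp add: add_increasing2)
    next
      case False
      \<comment> \<open>Here \<open>L < R\<close> bounds \<open>X\<close>, and the whole term goes
        into the constant.\<close>
      then have "rate_far = (1 - \<kappa>) * I1" unfolding rate_far_def by (simp add: r_def I1_def)
      moreover have "X \<le> real R * ln 2" unfolding X_def using False by (intro mult_right_mono) auto
      moreover have "1/2 * I1 \<le> (1 - \<kappa>) * I1" using \<kappa>_small I1 by (intro mult_right_mono) auto
      ultimately have "X / rate_far \<le> real R * ln 2 / (1/2 * I1)"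
        using I1 by (intro frac_le) auto
      moreover have "0 \<le> X / I" "0 \<le> \<eta> / 4 * X" using XY I \<eta> by simp_all
      ultimately show ?thesis by simp
    qed
    have "1 / 2^(R + 3) \<le> 1 / (2::real)^(r + 3)" using r_bounds by (intro divide_left_mono power_increasing) auto
    then have coarse: "1 / rate_coarse \<le> 1 / (D * (1 / 2^(R + 3))\<^sup>2)"
      unfolding rate_coarse_def D_def[symmetric] using D r_bounds
      by (intro divide_left_mono mult_left_mono power_mono mult_pos_pos) auto
    have near: "Y / rate_near \<le> Y / C + \<eta> / 2 * Y"
    proof -
      have "Y / rate_near = Y / C + 2 * \<kappa> / (1 - 2 * \<kappa>) * (Y / C)"
        unfolding rate_near_def C_def[symmetric] using \<kappa>_small C by (simp add: field_simps)
      \<comment> \<open>The error is measured against \<open>c \<le> C\<close>, which does not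
        depend on \<open>L\<close>.\<close>
      also have "2 * \<kappa> / (1 - 2 * \<kappa>) * (Y / C) \<le> 4 * \<kappa> * (Y / c)"
        using \<kappa>_small C XY by (intro mult_mono) (auto simp: field_simps)
      also have "\<dots> \<le> 4 * (\<eta> * c / 8) * (Y / c)"
        using \<kappa>_small c XY by (intro mult_right_mono mult_left_mono) auto
      also have "\<dots> = \<eta> / 2 * Y" using c by simp
      finally show ?thesis by simp
    qed
    have "X / rate_far + 1 / rate_mid + 1 / rate_coarse + (Y + overshoot) / rate_near
        \<le> X / I + Y / C + (\<eta> / 4 * X + \<eta> / 2 * Y) + W"
      using far coarse near overshoot_time
      by (simp add: W_def rate_mid_def D_def add_divide_distrib)
    also have "\<eta> / 4 * X \<le> \<eta> / 2 * X" using \<eta> XY by (intro mult_right_mono) auto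
    finally have "X / rate_far + 1 / rate_mid + 1 / rate_coarse + (Y + overshoot) / rate_near
        \<le> X / I + Y / C + \<eta> * (X + Y)"
      using WM by (simp add: algebra_simps)
    then have "expected_tau p L \<epsilon> \<le> ennreal (X / I + Y / C + \<eta> * (X + Y))"
      using expected_tau_bound[OF \<epsilon>] unfolding X_def Y_def by (meson ennreal_leI order_trans)
    then show "expected_tau p L \<epsilon> \<le>
         ennreal (ln (1 / (1 / 2^L)) / mutual_info_bsc (1/2) (p (2 powr (- l)))
                  + ln (1 / \<epsilon>) / C1 (p (1 / 2^L))
                  + \<eta> * ln (1 / (1 / 2^L * \<epsilon>)))"
      unfolding ln_delta ln_prod by (simp add: I_def C_def Y_def)
  qed
qed

end
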